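(* In the setting described in the context, assume the density family and parameter set satisfy assumptions A1–A4. Let $\mathcal{L}$ be any allocation rule such that for every parameter vector $\boldsymbol{\psi}=(\psi_1,\dots,\psi_M)\in\Psi^M$, its regret satisfies $\mathfrak{R}_{\mathcal{L}}(T)=o(T^b)$ as $T\to\infty$ for every $b>0$. Let $N_i(T)$ be the number of slots among the first $T$ in which $\mathcal{L}$ uses channel $i$. Then for every parameter vector $\boldsymbol{\psi}$ and every channel $i\notin\mathcal{O}_{\boldsymbol{\psi}}$, $$\liminf_{T\to\infty}\mathbb{E}_{\boldsymbol{\psi}}\left[\frac{N_i(T)}{\ln T}\right]\ge\max_{j\in\mathcal{O}_{\boldsymbol{\psi}}}\frac{1}{I(\psi_i,\psi_j)}.$$
   Context: Setting. A finite battery-state space $\mathcal{S}$, a finite set $\mathcal{A}$ of transmit power levels, allowed actions $\mathcal{A}_s\subseteq\mathcal{A}$, known transition probabilities $P(s'\mid s,a)$; the MDP is ergodic (every deterministic stationary policy $\beta$ induces an irreducible aperiodic chain with stationary distribution $\pi_\beta$). There are $M$ channels; the gain of channel $j$ is i.i.d. over slots with density $g(x;\psi_j)$ with respect to a measure $\nu$ on the gain space $\mathcal{X}\subseteq[0,\infty)$, where $g(\cdot;\cdot)$ is known and $\psi_j\in\Psi$ is unknown. If at slot $t$ power $a\in\mathcal{A}_{s_t}$ and channel $j$ are chosen, the reward is $f(a,X_{j,t})$ with rate function $f(a,x)=B\log_2(1+ax)$, the next state is drawn from $P(\cdot\mid s_t,a)$, and only the gain $X_{j,t}$ of the chosen channel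 is observed. An allocation rule chooses at each slot an allowed power and a channel as a (possibly randomized) function of past states, past choices and the gains observed on the chosen channels. Let $\mu(a;\psi)=\int_{\mathcal{X}}f(a,x)g(x;\psi)\,d\nu(x)$, $\mu_j(a)=\mu(a;\psi_j)$, $\phi^*(a)=\arg\max_j\mu_j(a)$, and let $\beta^*$ maximize $\rho(\beta,\phi^* )=\sum_s\pi_\beta(s)\mu_{\phi^*(\beta(s))}(\beta(s))$, with $\rho^*$ the maximum; these depend on $\boldsymbol{\psi}$. The regret of $\mathcal{L}$ is $\mathfrak{R}_{\mathcal{L}}(T)=T\rho^*-\mathbb{E}_{\boldsymbol{\psi}}[\sum_{t=1}^Tr_t]$, where $\mathbb{P}_{\boldsymbol{\psi}},\mathbb{E}_{\boldsymbol{\psi}}$ denote probability and expectation under $\boldsymbol{\psi}$. The set of optimal channels is $\mathcal{O}_{\boldsymbol{\psi}}=\{j:\exists s\in\mathcal{S}\text{ with }\phi^*(\beta^*(s))=j\}$. The Kullback–Leibler distance is $I(\psi,\psi')=\int_{\mathcal{X}}\ln\frac{g(x;\psi)}{g(x;\psi')}\,g(x;\psi)\,d\nu(x)$. A1: $\mu(a;\psi)<\infty$ for all $\psi\in\Psi$, $a\in\mathcal{A}$. A2: for all $\psi\in\Psi$, $a\in\mathcal{A}$, $\delta>0$ there is $\psi'\in\Psi$ with $\mu(a;\psi)<\mu(a;\psi')<\mu(a;\psi)+\delta$. A3: $0<I(\psi,\psi')<\infty$ whenever $\mu(a;\psi)<\mu(a;\psi')$ for some $a\in\mathcal{A}$.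 A4: for all $\epsilon>0$, $a\in\mathcal{A}$ and $\psi,\psi'\in\Psi$ with $\mu(a;\psi)<\mu(a;\psi')$ there is $\delta>0$ such that $|I(\psi,\psi')-I(\psi,\psi'')|<\epsilon$ whenever $\mu(a;\psi')<\mu(a;\psi'')<\mu(a;\psi')+\delta$. *)

theory Defs
  imports "HOL-Probability.Probability" "HOL-Library.Landau_Symbols"
begin

fun mpow :: "('s::finite \<Rightarrow> 's \<Rightarrow> real) \<Rightarrow> nat \<Rightarrow> 's \<Rightarrow> 's \<Rightarrow> real" where
  "mpow Q 0 s s' = (if s = s' then 1 else 0)"
| "mpow Q (Suc n) s s' = (\<Sum>u\<in>UNIV. mpow Q n s u * Q u s')"

definition irreducible_chain :: "('s::finite \<Rightarrow> 's \<Rightarrow> real) \<Rightarrow> bool" where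
  "irreducible_chain Q \<longleftrightarrow> (\<forall>s s'. \<exists>n. mpow Q n s s' > 0)"

definition aperiodic_chain :: "('s::finite \<Rightarrow> 's \<Rightarrow> real) \<Rightarrow> bool" where
  "aperiodic_chain Q \<longleftrightarrow> (\<forall>s. Gcd {n. n > 0 \<and> mpow Q n s s > 0} = 1)"

definition stationary_dist :: "('s::finite \<Rightarrow> 's \<Rightarrow> real) \<Rightarrow> 's \<Rightarrow> real" where
  "stationary_dist Q = (THE \<pi>. (\<forall>s. \<pi> s \<ge> 0) \<and> (\<Sum>s\<in>UNIV. \<pi> s) = 1 \<and>
                              (\<forall>s'. (\<Sum>s\<in>UNIV. \<pi> s * Q s s') = \<pi> s'))"

definition policies :: "('s::finite \<Rightarrow> real set) \<Rightarrow> ('s \<Rightarrow> real) set" where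
  "policies As = {\<beta>. \<forall>s. \<beta> s \<in> As s}"

definition induced_chain :: "('s \<Rightarrow> real \<Rightarrow> 's \<Rightarrow> real) \<Rightarrow> ('s \<Rightarrow> real) \<Rightarrow> 's \<Rightarrow> 's \<Rightarrow> real" where
  "induced_chain P \<beta> s s' = P s (\<beta> s) s'"

definition rate :: "real \<Rightarrow> real \<Rightarrow> real \<Rightarrow> real" where
  "rate B a x = B * log 2 (1 + a * x)"

definition mean_rate :: "real \<Rightarrow> real measure \<Rightarrow> (real \<Rightarrow> 'p \<Rightarrow> real) \<Rightarrow> real \<Rightarrow> 'p \<Rightarrow> real" where
  "mean_rate B \<nu> g a \<psi> = (\<integral>x. rate B a x * g x \<psi> \<partial>\<nu>)"

text \<open>Kullback-Leibler distance I(psi,psi') (as a real number; its finiteness is kl_finite).\<close>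
definition KL :: "real measure \<Rightarrow> (real \<Rightarrow> 'p \<Rightarrow> real) \<Rightarrow> 'p \<Rightarrow> 'p \<Rightarrow> real" where
  "KL \<nu> g \<psi> \<psi>' = (\<integral>x. ln (g x \<psi> / g x \<psi>') * g x \<psi> \<partial>\<nu>)"

definition kl_finite :: "real measure \<Rightarrow> (real \<Rightarrow> 'p \<Rightarrow> real) \<Rightarrow> 'p \<Rightarrow> 'p \<Rightarrow> bool" where
  "kl_finite \<nu> g \<psi> \<psi>' \<longleftrightarrow>
     (AE x in \<nu>. g x \<psi> > 0 \<longrightarrow> g x \<psi>' > 0) \<and>
     integrable \<nu> (\<lambda>x. ln (g x \<psi> / g x \<psi>') * g x \<psi>)"

definition best_mean :: "real \<Rightarrow> real measure \<Rightarrow> (real \<Rightarrow> 'p \<Rightarrow> real) \<Rightarrow> nat \<Rightarrow> (nat \<Rightarrow> 'p)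
                          \<Rightarrow> real \<Rightarrow> real" where
  "best_mean B \<nu> g M \<psi> a = Max ((\<lambda>j. mean_rate B \<nu> g a (\<psi> j)) ` {..<M})"

definition avg_reward :: "real \<Rightarrow> real measure \<Rightarrow> (real \<Rightarrow> 'p \<Rightarrow> real) \<Rightarrow> nat \<Rightarrow> (nat \<Rightarrow> 'p)
     \<Rightarrow> ('s::finite \<Rightarrow> real \<Rightarrow> 's \<Rightarrow> real) \<Rightarrow> ('s \<Rightarrow> real) \<Rightarrow> real" where
  "avg_reward B \<nu> g M \<psi> P \<beta> =
     (\<Sum>s\<in>UNIV. stationary_dist (induced_chain P \<beta>) s * best_mean B \<nu> g M \<psi> (\<beta> s))"

definition opt_reward :: "real \<Rightarrow> real measure \<Rightarrow> (real \<Rightarrow> 'p \<Rightarrow> real) \<Rightarrow> nat \<Rightarrow> (nat \<Rightarrow> 'p)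
     \<Rightarrow> ('s::finite \<Rightarrow> real \<Rightarrow> 's \<Rightarrow> real) \<Rightarrow> ('s \<Rightarrow> real set) \<Rightarrow> real" where
  "opt_reward B \<nu> g M \<psi> P As = Max (avg_reward B \<nu> g M \<psi> P ` policies As)"

text \<open>Set of optimal channels: j is optimal if it is a best channel phi*(beta*(s)) for
  some state s and some optimal policy beta* (ties allowed in both argmax's).\<close>
definition opt_channels :: "real \<Rightarrow> real measure \<Rightarrow> (real \<Rightarrow> 'p \<Rightarrow> real) \<Rightarrow> nat \<Rightarrow> (nat \<Rightarrow> 'p)
     \<Rightarrow> ('s::finite \<Rightarrow> real \<Rightarrow> 's \<Rightarrow> real) \<Rightarrow> ('s \<Rightarrow> real set) \<Rightarrow> nat set" where
  "opt_channels B \<nu> g M \<psi> P As =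
     {j. j < M \<and> (\<exists>\<beta>\<in>policies As.
           avg_reward B \<nu> g M \<psi> P \<beta> = opt_reward B \<nu> g M \<psi> P As \<and>
           (\<exists>s. mean_rate B \<nu> g (\<beta> s) (\<psi> j) = best_mean B \<nu> g M \<psi> (\<beta> s)))}"

text \<open>A history up to slot t is a function h on {..<t}: h k = (state, power, channel, observed gain)
  at slot k (undefined outside {..<t}).  An allocation rule L maps (t, history, current state)
  to a distribution on (power, channel).\<close>
type_synonym 's hist = "nat \<Rightarrow> 's \<times> real \<times> nat \<times> real"
type_synonym 's alloc_rule = "nat \<Rightarrow> 's hist \<Rightarrow> 's \<Rightarrow> (real \<times> nat) pmf"

definition hist_space :: "nat \<Rightarrow> 's hist measure" where
  "hist_space t = PiM {..<t} (\<lambda>_. count_space UNIV \<Otimes>\<^sub>M count_space UNIV \<Otimes>\<^sub>M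
                                     count_space UNIV \<Otimes>\<^sub>M (borel :: real measure))"

definition is_alloc_rule :: "nat \<Rightarrow> ('s \<Rightarrow> real set) \<Rightarrow> 's alloc_rule \<Rightarrow> bool" where
  "is_alloc_rule M As L \<longleftrightarrow>
     (\<forall>t h s. set_pmf (L t h s) \<subseteq> {(a, j). a \<in> As s \<and> j < M}) \<and>
     (\<forall>t s a j. (\<lambda>h. pmf (L t h s) (a, j)) \<in> borel_measurable (hist_space t))"

text \<open>exp_cum q n t h s: expected value of the sum over the next n slots of q(power, channel, gain),
  starting at slot t with history h in state s.  Gains of the chosen channel j have density
  g(.;psi_j) w.r.t. nu; the next state is drawn from P(.|s,a).\<close>
fun exp_cum :: "'s alloc_rule \<Rightarrow> ('s::finite \<Rightarrow> real \<Rightarrow> 's \<Rightarrow> real) \<Rightarrow> real measure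
     \<Rightarrow> (real \<Rightarrow> 'p \<Rightarrow> real) \<Rightarrow> (nat \<Rightarrow> 'p) \<Rightarrow> (real \<Rightarrow> nat \<Rightarrow> real \<Rightarrow> real)
     \<Rightarrow> nat \<Rightarrow> nat \<Rightarrow> 's hist \<Rightarrow> 's \<Rightarrow> ennreal" where
  "exp_cum L P \<nu> g \<psi> q 0 t h s = 0"
| "exp_cum L P \<nu> g \<psi> q (Suc n) t h s =
     (\<integral>\<^sup>+ aj. (\<integral>\<^sup>+ x. ennreal (g x (\<psi> (snd aj))) *
          (ennreal (q (fst aj) (snd aj) x) +
           (\<Sum>s'\<in>UNIV. ennreal (P s (fst aj) s') *
              exp_cum L P \<nu> g \<psi> q n (Suc t) (h(t := (s, fst aj, snd aj, x))) s')) \<partial>\<nu>)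
      \<partial>measure_pmf (L t h s))"

definition expected_reward :: "real \<Rightarrow> 's alloc_rule \<Rightarrow> ('s::finite \<Rightarrow> real \<Rightarrow> 's \<Rightarrow> real)
     \<Rightarrow> real measure \<Rightarrow> (real \<Rightarrow> 'p \<Rightarrow> real) \<Rightarrow> (nat \<Rightarrow> 'p) \<Rightarrow> 's \<Rightarrow> nat \<Rightarrow> real" where
  "expected_reward B L P \<nu> g \<psi> s0 T =
     enn2real (exp_cum L P \<nu> g \<psi> (\<lambda>a j x. rate B a x) T 0 (\<lambda>_. undefined) s0)"

definition expected_uses :: "'s alloc_rule \<Rightarrow> ('s::finite \<Rightarrow> real \<Rightarrow> 's \<Rightarrow> real)
     \<Rightarrow> real measure \<Rightarrow> (real \<Rightarrow> 'p \<Rightarrow> real) \<Rightarrow> (nat \<Rightarrow> 'p) \<Rightarrow> 's \<Rightarrow> nat \<Rightarrow> nat \<Rightarrow> real" where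
  "expected_uses L P \<nu> g \<psi> s0 i T =
     enn2real (exp_cum L P \<nu> g \<psi> (\<lambda>a j x. if j = i then 1 else 0) T 0 (\<lambda>_. undefined) s0)"

definition regret :: "real \<Rightarrow> nat \<Rightarrow> ('s \<Rightarrow> real set) \<Rightarrow> 's alloc_rule
     \<Rightarrow> ('s::finite \<Rightarrow> real \<Rightarrow> 's \<Rightarrow> real) \<Rightarrow> real measure \<Rightarrow> (real \<Rightarrow> 'p \<Rightarrow> real)
     \<Rightarrow> (nat \<Rightarrow> 'p) \<Rightarrow> 's \<Rightarrow> nat \<Rightarrow> real" where
  "regret B M As L P \<nu> g \<psi> s0 T =
     real T * opt_reward B \<nu> g M \<psi> P As - expected_reward B L P \<nu> g \<psi> s0 T"

end

theory Submission
  imports Defs "HOL-Real_Asymp.Real_Asymp"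
begin

text \<open>Fix an optimal channel \<open>j\<close>, best at a power \<open>a\<close> used by an optimal policy. By A2 and A4,
  replace \<open>\<psi> i\<close> by some \<open>p\<close> with mean at \<open>a\<close> slightly above that of \<open>\<psi> j\<close> and
  \<open>KL (\<psi> i) p\<close> close to \<open>KL (\<psi> i) (\<psi> j)\<close>. The modified problem has a strictly larger optimal gain, so by
  its Bellman equation there is a state \<open>z\<close> in which every choice of a channel other than \<open>i\<close> costs
  at least some \<open>D > 0\<close> of regret. As \<open>z\<close> is visited linearly often up to exponentially small
  probability, small regret forces \<open>Y = max 0 (1 - N_i(T) / cT)\<close> to have expectation
  \<open>O(T powr (b - 1))\<close> in the modified problem. The Donsker-Varadhan inequality
  \<open>E F \<le> ln (E' (exp F)) + KL (\<psi> i) p * E N_i(T)\<close> for \<open>F = (1 - 2 b) * ln T * Y\<close> then bounds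
  \<open>E N_i(T)\<close> from below, since \<open>E Y \<ge> 1 - E N_i(T) / cT\<close>. The inequality is proved by induction
  on the horizon, so no path measure is needed.\<close>

section \<open>Finite Markov chains and the Bellman inequality\<close>

text \<open>A3 and A4 control only the expectation of log-likelihood ratios. A variational
  inequality uses nothing else: the relative entropy of the two histories is \<open>KL\<close> times
  the expected number of uses of channel \<open>i\<close>, which is the quantity to be bounded, and
  no law of large numbers for likelihood ratios enters.

  The threshold \<open>cT\<close> is linear although the bound is logarithmic. In the original
  problem a logarithmic number of uses is negligible against \<open>cT\<close>, so \<open>Y\<close>
  stays near 1. In the modified problem the visits to \<open>z\<close> fall below \<open>cT\<close>
  only with exponentially small probability; otherwise \<open>Y\<close> is at most the number of
  losses divided by \<open>cT\<close>, so that the linear scale supplies the factor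
  \<open>1 / T\<close>.

  The obstacle is that the rule may depend on the whole history, so the states need not form a
  Markov chain. The Bellman and drift inequalities hold for every allowed power in every state,
  hence along any rule; stationary policies serve only to construct their solutions.\<close>

definition stochastic :: "('s::finite \<Rightarrow> 's \<Rightarrow> real) \<Rightarrow> bool" where
  "stochastic Q \<longleftrightarrow> (\<forall>s s'. 0 \<le> Q s s') \<and> (\<forall>s. (\<Sum>s'\<in>UNIV. Q s s') = 1)"

lemma mpow_nonneg: "stochastic Q \<Longrightarrow> 0 \<le> mpow Q n s s'"
  by (induction n arbitrary: s') (auto simp: stochastic_def intro!: sum_nonneg mult_nonneg_nonneg)

lemma mpow_row_sum: "stochastic Q \<Longrightarrow> (\<Sum>s'\<in>UNIV. mpow Q n s s') = 1"
proof (induction n)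
  case (Suc n)
  have "(\<Sum>s'\<in>UNIV. mpow Q (Suc n) s s') = (\<Sum>u\<in>UNIV. \<Sum>s'\<in>UNIV. mpow Q n s u * Q u s')"
    by (simp, rule sum.swap)
  also have "\<dots> = (\<Sum>u\<in>UNIV. mpow Q n s u)"
    using Suc.prems by (simp add: stochastic_def flip: sum_distrib_left)
  finally show ?case using Suc by simp
qed simp

text \<open>Maximum principle: at a maximizer every n-step average is at least the maximum, so no
  state reached with positive probability can lie below it.\<close>

lemma subharmonic_const:
  fixes b :: "'s::finite \<Rightarrow> real"
  assumes Q: "stochastic Q" and irr: "irreducible_chain Q"
    and sub: "\<And>s. b s \<le> (\<Sum>s'\<in>UNIV. Q s s' * b s')"
  shows "b u = b v"
proof -
  define m where "m = Max (range b)"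
  have bm: "b u \<le> m" for u by (simp add: m_def)
  have "m \<in> range b" unfolding m_def by (rule Max_in) auto
  then obtain z where z: "b z = m" by auto
  have iter: "b z \<le> (\<Sum>u\<in>UNIV. mpow Q n z u * b u)" for n
  proof (induction n)
    case (Suc n)
    have "(\<Sum>u\<in>UNIV. mpow Q n z u * b u)
        \<le> (\<Sum>u\<in>UNIV. mpow Q n z u * (\<Sum>s'\<in>UNIV. Q u s' * b s'))"
      by (intro sum_mono mult_left_mono sub mpow_nonneg Q)
    also have "\<dots> = (\<Sum>s'\<in>UNIV. \<Sum>u\<in>UNIV. mpow Q n z u * Q u s' * b s')"
      unfolding sum_distrib_left by (subst sum.swap) (simp add: mult.assoc)
    also have "\<dots> = (\<Sum>u\<in>UNIV. mpow Q (Suc n) z u * b u)" by (simp add: sum_distrib_right)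
    finally show ?case using Suc by simp
  qed (simp add: if_distrib[where f = "\<lambda>x. x * _"] cong: if_cong)
  have "b w = m" for w
  proof -
    obtain n where n: "mpow Q n z w > 0" using irr unfolding irreducible_chain_def by blast
    have nn: "0 \<le> mpow Q n z u * (m - b u)" for u
      using mpow_nonneg[OF Q] bm by (simp add: mult_nonneg_nonneg)
    have "(\<Sum>u\<in>UNIV. mpow Q n z u * (m - b u)) \<le> 0"
      using iter[of n] mpow_row_sum[OF Q, of n z] z
      by (simp add: right_diff_distrib sum_subtractf flip: sum_distrib_right)
    with nn have "mpow Q n z w * (m - b w) = 0"
      using sum_nonneg_eq_0_iff[of UNIV "\<lambda>u. mpow Q n z u * (m - b u)"] sum_nonneg[of UNIV "\<lambda>u. mpow Q n z u * (m - b u)"]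
      by (metis UNIV_I finite order_antisym)
    with n show ?thesis by simp
  qed
  then show ?thesis by metis
qed

lemma superharmonic_const:
  fixes b :: "'s::finite \<Rightarrow> real"
  assumes "stochastic Q" "irreducible_chain Q" "\<And>s. (\<Sum>s'\<in>UNIV. Q s s' * b s') \<le> b s"
  shows "b u = b v"
  using subharmonic_const[of Q "\<lambda>s. - b s" u v] assms by (simp add: sum_negf)

text \<open>Adding the rank-one term \<open>b z\<close> to \<open>I - Q\<close>, whose kernel is the constants, makes it
  invertible; a solution of the perturbed system then carries its own average \<open>b z\<close>.\<close>

definition perturbed :: "('s::finite \<Rightarrow> 's \<Rightarrow> real) \<Rightarrow> 's \<Rightarrow> real^'s \<Rightarrow> real^'s" where
  "perturbed Q z b = (\<chi> s. b $ s - (\<Sum>s'\<in>UNIV. Q s s' * b $ s') + b $ z)"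

lemma linear_perturbed: "linear (perturbed Q z)"
  by (rule linearI)
    (auto simp: perturbed_def vec_eq_iff algebra_simps sum.distrib sum_distrib_left)

text \<open>On the kernel \<open>Q b = b + b z\<close>, so the sign of \<open>b z\<close> makes
  \<open>b\<close> subharmonic or superharmonic. Either way \<open>b\<close> is constant, and then
  the equation itself gives \<open>b z = 0\<close>.\<close>

lemma inj_perturbed:
  assumes Q: "stochastic Q" and irr: "irreducible_chain Q"
  shows "inj (perturbed Q z)"
  unfolding linear_injective_0[OF linear_perturbed]
proof (intro allI impI)
  fix b assume "perturbed Q z b = 0"
  then have eq: "b $ s - (\<Sum>s'\<in>UNIV. Q s s' * b $ s') + b $ z = 0" for s
    by (simp add: perturbed_def vec_eq_iff)
  have "b $ u = b $ v" for u v
  proof (cases "b $ z \<ge> 0")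
    case True
    show ?thesis
      by (rule subharmonic_const[OF Q irr, of "\<lambda>s. b $ s"]) (use True eq in \<open>smt (verit)\<close>)
  next
    case False
    show ?thesis
      by (rule superharmonic_const[OF Q irr, of "\<lambda>s. b $ s"]) (use False eq in \<open>smt (verit)\<close>)
  qed
  then have c: "b $ u = b $ z" for u by blast
  have "(\<Sum>s'\<in>UNIV. Q z s' * b $ s') = b $ z"
    using Q by (subst c) (simp add: stochastic_def flip: sum_distrib_right)
  with eq[of z] c show "b = 0" by (simp add: vec_eq_iff)
qed

lemma poisson_equation:
  fixes r :: "'s::finite \<Rightarrow> real"
  assumes "stochastic Q" "irreducible_chain Q"
  obtains b \<rho> where "\<And>s. r s + (\<Sum>s'\<in>UNIV. Q s s' * b s') = \<rho> + b s"
proof -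
  obtain z :: 's where True by simp
  have "surj (perturbed Q z)"
    using linear_inj_imp_surj[OF linear_perturbed inj_perturbed[OF assms]] .
  then obtain b where "perturbed Q z b = (\<chi> s. r s)" by (metis surjD)
  then have "b $ s - (\<Sum>s'\<in>UNIV. Q s s' * b $ s') + b $ z = r s" for s
    by (simp add: perturbed_def vec_eq_iff)
  then show thesis by (intro that[of "\<lambda>s. b $ s" "b $ z"]) (smt (verit))
qed

section \<open>Stationary distributions\<close>

definition is_stationary :: "('s::finite \<Rightarrow> 's \<Rightarrow> real) \<Rightarrow> ('s \<Rightarrow> real) \<Rightarrow> bool" where
  "is_stationary Q \<pi> \<longleftrightarrow> (\<forall>s. \<pi> s \<ge> 0) \<and> (\<Sum>s\<in>UNIV. \<pi> s) = 1 \<and>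
     (\<forall>s'. (\<Sum>s\<in>UNIV. \<pi> s * Q s s') = \<pi> s')"

lemma stationary_sum:
  assumes "is_stationary Q \<pi>"
  shows "(\<Sum>s\<in>UNIV. \<pi> s * (\<Sum>s'\<in>UNIV. Q s s' * b s')) = (\<Sum>s\<in>UNIV. \<pi> s * b s)"
proof -
  have "(\<Sum>s\<in>UNIV. \<pi> s * (\<Sum>s'\<in>UNIV. Q s s' * b s')) = (\<Sum>s'\<in>UNIV. (\<Sum>s\<in>UNIV. \<pi> s * Q s s') * b s')"
    unfolding sum_distrib_left sum_distrib_right by (subst sum.swap) (simp add: mult.assoc)
  then show ?thesis using assms by (simp add: is_stationary_def)
qed

text \<open>Integrating against a stationary distribution cancels \<open>b\<close>. The defect
  \<open>e\<close> is there for policies that violate the equation of another policy in a single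
  state.\<close>

lemma stationary_average:
  assumes \<pi>: "is_stationary Q \<pi>"
    and eq: "\<And>s. r s + (\<Sum>s'\<in>UNIV. Q s s' * b s') = \<rho> + b s + e s"
  shows "(\<Sum>s\<in>UNIV. \<pi> s * r s) = \<rho> + (\<Sum>s\<in>UNIV. \<pi> s * e s)"
proof -
  have "(\<Sum>s\<in>UNIV. \<pi> s * r s)
      = (\<Sum>s\<in>UNIV. \<pi> s * (\<rho> + b s + e s - (\<Sum>s'\<in>UNIV. Q s s' * b s')))"
    by (intro sum.cong refl arg_cong2[where f = "(*)"]) (use eq in \<open>smt (verit)\<close>)
  also have "\<dots> = (\<Sum>s\<in>UNIV. \<pi> s) * \<rho> + (\<Sum>s\<in>UNIV. \<pi> s * e s)"
    using stationary_sum[OF \<pi>, of b]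
    by (simp add: algebra_simps sum.distrib sum_subtractf sum_distrib_left)
  finally show ?thesis using \<pi> by (simp add: is_stationary_def)
qed

text \<open>The map from a reward \<open>r\<close> to the average \<open>T r $ z\<close> in its
  Poisson equation is a linear functional. Its representing vector, obtained from the adjoint, is
  the stationary distribution.\<close>

lemma ex_stationary:
  fixes Q :: "'s::finite \<Rightarrow> 's \<Rightarrow> real"
  assumes Q: "stochastic Q" and irr: "irreducible_chain Q"
  shows "\<exists>\<pi>. is_stationary Q \<pi>"
proof -
  obtain z :: 's where True by simp
  obtain T where linT: "linear T" and Tp: "\<And>b. T (perturbed Q z b) = b"
    and pT: "\<And>r. perturbed Q z (T r) = r"
    using linear_injective_isomorphism[OF linear_perturbed inj_perturbed[OF Q irr]] by metis
  define \<pi> where "\<pi> = adjoint T (axis z 1)"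
  have \<pi>: "(\<Sum>s\<in>UNIV. r $ s * \<pi> $ s) = T r $ z" for r
    using adjoint_works[OF linT, of r "axis z 1"]
    by (simp add: \<pi>_def inner_vec_def axis_def if_distrib cong: if_cong)
  \<comment> \<open>Minimum principle: at a minimizer \<open>m\<close> of \<open>b\<close> the
    average \<open>Q b\<close> is at least \<open>b m\<close>, which leaves \<open>r m\<close> at
    most \<open>b z\<close>.\<close>
  have nonneg: "T r $ z \<ge> 0" if "\<And>s. r $ s \<ge> 0" for r
  proof -
    define b where "b = T r"
    have "Min (range (($) b)) \<in> range (($) b)" by (rule Min_in) auto
    then obtain m where "b $ m = Min (range (($) b))" by (metis imageE)
    then have m: "b $ m \<le> b $ s" for s by simp
    have "b $ m = (\<Sum>s'\<in>UNIV. Q m s' * b $ m)"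
      using Q by (simp add: stochastic_def flip: sum_distrib_right)
    also have "\<dots> \<le> (\<Sum>s'\<in>UNIV. Q m s' * b $ s')"
      using Q by (intro sum_mono mult_left_mono m) (auto simp: stochastic_def)
    finally have "r $ m \<le> b $ z"
      using pT[of r, folded b_def, THEN arg_cong, of "\<lambda>v. v $ m"] by (simp add: perturbed_def)
    with that[of m] show ?thesis by (simp add: b_def)
  qed
  have "\<pi> $ s \<ge> 0" for s
    using \<pi>[of "axis s 1"] nonneg[of "axis s 1"]
    by (simp add: axis_def if_distrib[where f = "\<lambda>x. x * _"] cong: if_cong)
  moreover have "(\<Sum>s\<in>UNIV. \<pi> $ s) = 1"
  proof -
    have "perturbed Q z (\<chi> s. 1) = (\<chi> s. 1)" using Q by (simp add: perturbed_def vec_eq_iff stochastic_def)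
    then show ?thesis using \<pi>[of "\<chi> s. 1"] Tp[of "\<chi> s. 1"] by simp
  qed
  \<comment> \<open>Stationarity says that the functional kills the reward
    \<open>1_u - Q 1_u\<close>. The Poisson solution of that reward is \<open>1_u\<close>, shifted
    by a constant so as to vanish at \<open>z\<close>.\<close>
  moreover have "(\<Sum>s\<in>UNIV. \<pi> $ s * Q s u) = \<pi> $ u" for u
  proof -
    have "perturbed Q z (axis u 1 - (\<chi> s. axis u 1 $ z)) = (\<chi> s. axis u 1 $ s - Q s u)"
      using Q by (auto simp: perturbed_def vec_eq_iff stochastic_def axis_def algebra_simps sum_subtractf
          if_distrib[where f = "\<lambda>x. x * _"] if_distrib[where f = "\<lambda>x. _ * x"] sum.distrib simp flip: sum_distrib_right cong: if_cong)
    then have "(\<Sum>s\<in>UNIV. (axis u 1 $ s - Q s u) * \<pi> $ s) = 0"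
      using \<pi>[of "\<chi> s. axis u 1 $ s - Q s u"] Tp[of "axis u 1 - (\<chi> s. axis u 1 $ z)"] by simp
    then have "(\<Sum>s\<in>UNIV. \<pi> $ s * (if s = u then 1 else 0)) - (\<Sum>s\<in>UNIV. \<pi> $ s * Q s u) = 0"
      by (simp add: right_diff_distrib sum_subtractf axis_def mult.commute)
    then show ?thesis by (simp add: if_distrib cong: if_cong)
  qed
  ultimately show ?thesis unfolding is_stationary_def by blast
qed

text \<open>For the reward \<open>1\<close> at \<open>u\<close> and \<open>0\<close> elsewhere,
  every stationary distribution must give \<open>u\<close> the same constant \<open>\<rho>\<close>
  of one Poisson equation.\<close>

lemma stationary_unique:
  assumes Q: "stochastic Q" "irreducible_chain Q"
    and "is_stationary Q \<pi>" "is_stationary Q \<pi>'"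
  shows "\<pi> = \<pi>'"
proof
  fix u
  obtain b \<rho> where b: "\<And>s. (if s = u then 1 else 0) + (\<Sum>s'\<in>UNIV. Q s s' * b s') = \<rho> + b s"
    using poisson_equation[OF Q, of "\<lambda>s. if s = u then 1 else 0"] by metis
  have "p u = \<rho>" if "is_stationary Q p" for p
    using stationary_average[OF that, of "\<lambda>s. if s = u then 1 else 0" b \<rho> "\<lambda>_. 0"] b
    by (simp add: if_distrib cong: if_cong)
  with assms(3,4) show "\<pi> u = \<pi>' u" by metis
qed

lemma stationary_dist_is_stationary:
  assumes "stochastic Q" "irreducible_chain Q"
  shows "is_stationary Q (stationary_dist Q)"
proof -
  have "\<exists>!\<pi>. is_stationary Q \<pi>"
    using ex_stationary[OF assms] stationary_unique[OF assms] by blast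
  then have "is_stationary Q (THE \<pi>. is_stationary Q \<pi>)" by (rule theI')
  then show ?thesis unfolding is_stationary_def stationary_dist_def .
qed

text \<open>A stationary distribution is also stationary for all powers of \<open>Q\<close>, and
  some power carries mass from a charged state to \<open>u\<close>. This strictness turns a
  one-state improvement into an improvement of the average.\<close>

lemma stationary_dist_pos:
  assumes Q: "stochastic Q" and irr: "irreducible_chain Q"
  shows "stationary_dist Q u > 0"
proof -
  define \<pi> where "\<pi> = stationary_dist Q"
  have st: "is_stationary Q \<pi>"
    unfolding \<pi>_def using stationary_dist_is_stationary[OF Q irr] .
  then have nn: "\<pi> s \<ge> 0" for s by (simp add: is_stationary_def)
  obtain z where z: "\<pi> z > 0"
    using st nn unfolding is_stationary_def
    by (metis less_eq_real_def sum.neutral zero_neq_one)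
  obtain n where n: "mpow Q n z u > 0" using irr unfolding irreducible_chain_def by blast
  have "(\<Sum>s\<in>UNIV. \<pi> s * mpow Q k s v) = \<pi> v" for k v
  proof (induction k arbitrary: v)
    case (Suc k)
    have "(\<Sum>s\<in>UNIV. \<pi> s * mpow Q (Suc k) s v)
        = (\<Sum>w\<in>UNIV. (\<Sum>s\<in>UNIV. \<pi> s * mpow Q k s w) * Q w v)"
      unfolding mpow.simps sum_distrib_left sum_distrib_right
      by (subst sum.swap) (simp add: mult.assoc)
    then show ?case using Suc st by (simp add: is_stationary_def)
  qed (simp add: if_distrib cong: if_cong)
  then have "\<pi> u = (\<Sum>s\<in>UNIV. \<pi> s * mpow Q n s u)" by simp
  also have "\<dots> \<ge> \<pi> z * mpow Q n z u"
    by (rule member_le_sum) (auto intro!: mult_nonneg_nonneg nn mpow_nonneg Q)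
  finally show ?thesis using z n by (smt (verit) \<pi>_def mult_pos_pos)
qed

section \<open>Finitely many policies and their optimality inequality\<close>

lemma policies_finite:
  assumes "\<And>s::'s::finite. finite (As s)"
  shows "finite (policies As)"
proof -
  have "policies As = PiE UNIV As" by (auto simp: policies_def)
  then show ?thesis using assms by (simp add: finite_PiE)
qed

lemma policies_nonempty:
  assumes "\<And>s. As s \<noteq> {}"
  shows "policies As \<noteq> {}"
proof -
  have "(\<lambda>s. SOME a. a \<in> As s) \<in> policies As"
    using assms by (auto simp: policies_def some_in_eq)
  then show ?thesis by auto
qed

lemma induced_stochastic:
  assumes "\<And>s a s'. a \<in> As s \<Longrightarrow> P s a s' \<ge> 0"
    and "\<And>s a. a \<in> As s \<Longrightarrow> (\<Sum>s'\<in>UNIV. P s a s') = 1"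
    and "\<beta> \<in> policies As"
  shows "stochastic (induced_chain P \<beta>)"
  using assms by (auto simp: stochastic_def induced_chain_def policies_def)

text \<open>The bias of an optimal stationary policy works: a violation at \<open>(s, a)\<close> would make the
  policy switched to \<open>a\<close> at \<open>s\<close> strictly better, as its stationary distribution charges \<open>s\<close>.\<close>

lemma bellman_inequality:
  fixes As :: "'s::finite \<Rightarrow> real set" and r :: "'s \<Rightarrow> real \<Rightarrow> real"
  assumes fin: "\<And>s. finite (As s)" and ne: "\<And>s. As s \<noteq> {}"
    and P0: "\<And>s a s'. a \<in> As s \<Longrightarrow> P s a s' \<ge> 0"
    and P1: "\<And>s a. a \<in> As s \<Longrightarrow> (\<Sum>s'\<in>UNIV. P s a s') = 1"
    and irr: "\<And>\<beta>. \<beta> \<in> policies As \<Longrightarrow> irreducible_chain (induced_chain P \<beta>)"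
  obtains b where "\<And>s a. a \<in> As s \<Longrightarrow> r s a + (\<Sum>s'\<in>UNIV. P s a s' * b s')
    \<le> Max ((\<lambda>\<beta>. \<Sum>s\<in>UNIV. stationary_dist (induced_chain P \<beta>) s * r s (\<beta> s)) ` policies As) + b s"
proof -
  define gain where
    "gain = (\<lambda>\<beta>. \<Sum>s\<in>UNIV. stationary_dist (induced_chain P \<beta>) s * r s (\<beta> s))"
  define \<rho> where "\<rho> = Max (gain ` policies As)"
  have stoch: "stochastic (induced_chain P \<beta>)" if "\<beta> \<in> policies As" for \<beta>
    using P0 P1 that by (rule induced_stochastic)
  have fp: "finite (policies As)" and np: "policies As \<noteq> {}"
    using policies_finite[of As] policies_nonempty[of As] fin ne by auto
  have le: "gain \<beta> \<le> \<rho>" if "\<beta> \<in> policies As" for \<beta>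
    using that fp by (simp add: \<rho>_def)
  have "\<rho> \<in> gain ` policies As" unfolding \<rho>_def using fp np by (intro Max_in) auto
  then obtain \<beta> where \<beta>: "\<beta> \<in> policies As" and opt: "gain \<beta> = \<rho>" by auto
  obtain b \<sigma> where
    b: "\<And>s. r s (\<beta> s) + (\<Sum>s'\<in>UNIV. induced_chain P \<beta> s s' * b s') = \<sigma> + b s"
    using poisson_equation[OF stoch[OF \<beta>] irr[OF \<beta>], of "\<lambda>s. r s (\<beta> s)"] by metis
  have "gain \<beta> = \<sigma>"
    unfolding gain_def
    using stationary_average[OF stationary_dist_is_stationary[OF stoch[OF \<beta>] irr[OF \<beta>]],
        of "\<lambda>s. r s (\<beta> s)" b \<sigma> "\<lambda>_. 0"] b by simp
  with opt have \<sigma>: "\<sigma> = \<rho>" by simp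
  show thesis
  proof (rule that[of b], fold gain_def, fold \<rho>_def)
    fix s a assume a: "a \<in> As s"
    define e where "e = r s a + (\<Sum>s'\<in>UNIV. P s a s' * b s') - (\<rho> + b s)"
    define \<beta>' where "\<beta>' = \<beta>(s := a)"
    have \<beta>': "\<beta>' \<in> policies As" using \<beta> a by (auto simp: policies_def \<beta>'_def)
    have "r u (\<beta>' u) + (\<Sum>s'\<in>UNIV. induced_chain P \<beta>' u s' * b s')
        = \<rho> + b u + (if u = s then e else 0)" for u
      using b[of u] by (auto simp: e_def \<beta>'_def induced_chain_def \<sigma>)
    then have "gain \<beta>' = \<rho> + (\<Sum>u\<in>UNIV. stationary_dist (induced_chain P \<beta>') u *
        (if u = s then e else 0))"
      unfolding gain_def
      by (rule stationary_average[OF stationary_dist_is_stationary[OF stoch[OF \<beta>'] irr[OF \<beta>']]])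
    also have "\<dots> = \<rho> + stationary_dist (induced_chain P \<beta>') s * e"
      by (simp add: if_distrib cong: if_cong)
    finally have "stationary_dist (induced_chain P \<beta>') s * e \<le> 0" using le[OF \<beta>'] by simp
    then have "e \<le> 0"
      using stationary_dist_pos[OF stoch[OF \<beta>'] irr[OF \<beta>'], of s]
      by (simp add: mult_le_0_iff)
    then show "r s a + (\<Sum>s'\<in>UNIV. P s a s' * b s') \<le> \<rho> + b s" by (simp add: e_def)
  qed
qed

section \<open>Expectations along the controlled process\<close>

text \<open>No parameter vector is fixed, because the process under \<psi> and under the modified
  vector are compared inside one and the same instance.\<close>

locale bandit =
  fixes As :: "'s::finite \<Rightarrow> real set" and M :: nat
    and P :: "'s \<Rightarrow> real \<Rightarrow> 's \<Rightarrow> real"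
    and \<nu> :: "real measure" and X :: "real set"
    and g :: "real \<Rightarrow> 'p \<Rightarrow> real" and \<Psi> :: "'p set"
    and L :: "'s alloc_rule"
  assumes As_fin: "\<And>s. finite (As s)"
    and P_nonneg: "\<And>s a s'. a \<in> As s \<Longrightarrow> P s a s' \<ge> 0"
    and P_sum: "\<And>s a. a \<in> As s \<Longrightarrow> (\<Sum>s'\<in>UNIV. P s a s') = 1"
    and nu_sets: "sets \<nu> = sets (restrict_space borel X)"
    and g_meas [measurable]: "\<And>p. p \<in> \<Psi> \<Longrightarrow> (\<lambda>x. g x p) \<in> borel_measurable \<nu>"
    and g_nonneg: "\<And>p x. p \<in> \<Psi> \<Longrightarrow> x \<in> X \<Longrightarrow> g x p \<ge> 0"
    and g_density: "\<And>p. p \<in> \<Psi> \<Longrightarrow> (\<integral>\<^sup>+ x. ennreal (g x p) \<partial>\<nu>) = 1"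
    and L_rule: "is_alloc_rule M As L"
begin

lemma space_nu: "space \<nu> = X"
  using sets_eq_imp_space_eq[OF nu_sets] by (simp add: space_restrict_space)

section \<open>Laws of the gains and relative entropy\<close>

definition G :: "'p \<Rightarrow> real measure" where
  "G p = density \<nu> (\<lambda>x. ennreal (g x p))"

lemma sets_G [measurable_cong]: "sets (G p) = sets \<nu>" and space_G: "space (G p) = X"
  by (simp_all add: G_def space_nu)

lemma prob_space_G: "p \<in> \<Psi> \<Longrightarrow> prob_space (G p)"
  by (rule prob_spaceI)
    (simp add: G_def emeasure_density g_density cong: nn_integral_cong_simp)

lemma AE_g_nonneg: "p \<in> \<Psi> \<Longrightarrow> AE x in \<nu>. 0 \<le> g x p"
  by (rule AE_I2) (simp add: space_nu g_nonneg)

lemma integrable_G: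
  assumes "p \<in> \<Psi>" "(f :: real \<Rightarrow> real) \<in> borel_measurable \<nu>"
  shows "integrable (G p) f \<longleftrightarrow> integrable \<nu> (\<lambda>x. g x p * f x)"
  unfolding G_def using assms AE_g_nonneg by (subst integrable_density) auto

lemma integral_G:
  assumes "p \<in> \<Psi>" "(f :: real \<Rightarrow> real) \<in> borel_measurable \<nu>"
  shows "(\<integral>x. f x \<partial>G p) = (\<integral>x. g x p * f x \<partial>\<nu>)"
  unfolding G_def using assms AE_g_nonneg by (subst integral_density) auto

lemma integrable_g: "p \<in> \<Psi> \<Longrightarrow> integrable \<nu> (\<lambda>x. g x p)"
  using integrable_G[of p "\<lambda>_. 1"] prob_space_G[of p] by (simp add: prob_space_def finite_measure.integrable_const)

lemma integral_g: "p \<in> \<Psi> \<Longrightarrow> (\<integral>x. g x p \<partial>\<nu>) = 1"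
  using integral_G[of p "\<lambda>_. 1"] prob_space_G[of p] by (simp add: prob_space.prob_space)

text \<open>One step of the change of measure: \<open>ln y \<le> y - 1\<close> at \<open>y = V g(x;p') / (c g(x;p))\<close>.\<close>

lemma integral_ln_le_KL:
  assumes p: "p \<in> \<Psi>" and p': "p' \<in> \<Psi>" and kl: "kl_finite \<nu> g p p'"
    and V [measurable]: "V \<in> borel_measurable \<nu>"
    and V1: "\<And>x. x \<in> X \<Longrightarrow> 1 \<le> V x" and VK: "\<And>x. x \<in> X \<Longrightarrow> V x \<le> K"
    and c: "c > 0"
  shows "(\<integral>x. ln (V x) \<partial>G p) \<le> (\<integral>x. V x \<partial>G p') / c - 1 + ln c + KL \<nu> g p p'"
proof -
  interpret G: prob_space "G p" by (rule prob_space_G[OF p])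
  interpret G': prob_space "G p'" by (rule prob_space_G[OF p'])
  note [measurable] = g_meas[OF p] g_meas[OF p']
  have kli: "integrable \<nu> (\<lambda>x. ln (g x p / g x p') * g x p)"
    and kla: "AE x in \<nu>. g x p > 0 \<longrightarrow> g x p' > 0"
    using kl by (auto simp: kl_finite_def)
  have "integrable (G p) (\<lambda>x. ln (V x))"
  proof (rule G.integrable_const_bound[where B = "ln K"])
    show "AE x in G p. norm (ln (V x)) \<le> ln K"
      using V1 VK by (intro AE_I2) (force simp: space_G intro: ln_mono order.trans)
  qed simp
  then have i1: "integrable \<nu> (\<lambda>x. g x p * ln (V x))" using p by (simp add: integrable_G)
  have "integrable (G p') V"
  proof (rule G'.integrable_const_bound[where B = "K"])
    show "AE x in G p'. norm (V x) \<le> K"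
      using V1 VK by (intro AE_I2) (force simp: space_G)
  qed simp
  then have i2: "integrable \<nu> (\<lambda>x. g x p' * V x)" using p' by (simp add: integrable_G)
  have "(\<integral>x. ln (V x) \<partial>G p) = (\<integral>x. g x p * ln (V x) \<partial>\<nu>)" using p by (simp add: integral_G)
  also have "\<dots> \<le> (\<integral>x. g x p' * V x / c - g x p + g x p * ln c + ln (g x p / g x p') * g x p \<partial>\<nu>)"
  proof (rule integral_mono_AE[OF i1])
    show "integrable \<nu> (\<lambda>x. g x p' * V x / c - g x p + g x p * ln c + ln (g x p / g x p') * g x p)"
      using i2 kli integrable_g[OF p] by auto
    show "AE x in \<nu>. g x p * ln (V x)
      \<le> g x p' * V x / c - g x p + g x p * ln c + ln (g x p / g x p') * g x p"
      using kla AE_g_nonneg[OF p] AE_g_nonneg[OF p'] AE_space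
    proof eventually_elim
      case (elim x)
      then have x: "x \<in> X" by (simp add: space_nu)
      show ?case
      proof (cases "g x p > 0")
        case True
        with elim have g': "g x p' > 0" by simp
        have "ln (V x * g x p' / (g x p * c)) \<le> V x * g x p' / (g x p * c) - 1"
          using True g' V1[OF x] c by (intro ln_le_minus_one) auto
        then have "ln (V x) \<le> V x * g x p' / (g x p * c) - 1 + ln c + ln (g x p / g x p')"
          using True g' V1[OF x] c by (simp add: ln_div ln_mult)
        then have "g x p * ln (V x)
            \<le> g x p * (V x * g x p' / (g x p * c) - 1 + ln c + ln (g x p / g x p'))"
          using True by (intro mult_left_mono) auto
        also have "\<dots> = g x p' * V x / c - g x p + g x p * ln c + ln (g x p / g x p') * g x p"
          using True c by (simp add: field_simps)
        finally show ?thesis .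
      next
        \<comment> \<open>Where \<open>g x p\<close> vanishes only \<open>g x p' * V x / c\<close>
          remains on the right; mass of \<open>p'\<close> off the support of \<open>p\<close> only
          helps.\<close>
        case False
        with elim have "g x p = 0" by simp
        then show ?thesis using elim c V1[OF x] by simp
      qed
    qed
  qed
  also have "\<dots> = (\<integral>x. V x \<partial>G p') / c - 1 + ln c + KL \<nu> g p p'"
    using i2 kli integrable_g[OF p] p p'
    by (simp add: integral_G integral_g KL_def)
  finally show ?thesis .
qed

section \<open>Bounded measurable functions of the history\<close>

definition params :: "(nat \<Rightarrow> 'p) \<Rightarrow> bool" where
  "params \<phi> \<longleftrightarrow> (\<forall>j<M. \<phi> j \<in> \<Psi>)"

lemma paramsD: "params \<phi> \<Longrightarrow> j < M \<Longrightarrow> \<phi> j \<in> \<Psi>"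
  by (simp add: params_def)

text \<open>The class is chosen to be stable under the one-step expectation, so that every integral
  below is one of a bounded function. Bounds are asked only on \<open>space (hist_space t)\<close>,
  which consists of functions that are \<open>undefined\<close> from \<open>t\<close> on.\<close>

definition bdd_meas :: "nat \<Rightarrow> ('s hist \<Rightarrow> 's \<Rightarrow> real) \<Rightarrow> bool" where
  "bdd_meas t W \<longleftrightarrow> (\<forall>s. (\<lambda>h. W h s) \<in> borel_measurable (hist_space t)) \<and>
     (\<exists>K. \<forall>h\<in>space (hist_space t). \<forall>s. \<bar>W h s\<bar> \<le> K)"

lemma admI:
  "(\<And>s. (\<lambda>h. W h s) \<in> borel_measurable (hist_space t)) \<Longrightarrow>
   (\<And>h s. h \<in> space (hist_space t) \<Longrightarrow> \<bar>W h s\<bar> \<le> K) \<Longrightarrow> bdd_meas t W"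
  unfolding bdd_meas_def by blast

lemma bdd_meas_measurable: "bdd_meas t W \<Longrightarrow> (\<lambda>h. W h s) \<in> borel_measurable (hist_space t)"
  by (simp add: bdd_meas_def)

lemma bdd_meas_const: "bdd_meas t (\<lambda>_ s. k s)"
  by (rule admI[where K = "\<Sum>s\<in>UNIV. \<bar>k s\<bar>"]) (auto intro: member_le_sum)

lemma bdd_meas_bound:
  assumes "bdd_meas t W"
  obtains K where "\<And>h s. h \<in> space (hist_space t) \<Longrightarrow> \<bar>W h s\<bar> \<le> K"
  using assms unfolding bdd_meas_def by blast

lemma bdd_meas_add:
  assumes "bdd_meas t U" "bdd_meas t W"
  shows "bdd_meas t (\<lambda>h s. U h s + W h s)"
proof -
  obtain K where K: "\<And>h s. h \<in> space (hist_space t) \<Longrightarrow> \<bar>U h s\<bar> \<le> K"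
    using bdd_meas_bound[OF assms(1)] by blast
  obtain K' where K': "\<And>h s. h \<in> space (hist_space t) \<Longrightarrow> \<bar>W h s\<bar> \<le> K'"
    using bdd_meas_bound[OF assms(2)] by blast
  show ?thesis
  proof (rule admI)
    show "(\<lambda>h. U h s + W h s) \<in> borel_measurable (hist_space t)" for s
      using bdd_meas_measurable[OF assms(1)] bdd_meas_measurable[OF assms(2)] by (rule borel_measurable_add)
    show "\<bar>U h s + W h s\<bar> \<le> K + K'" if "h \<in> space (hist_space t)" for h s
      using K[OF that, of s] K'[OF that, of s] by linarith
  qed
qed

lemma bdd_meas_cmult:
  assumes "bdd_meas t U"
  shows "bdd_meas t (\<lambda>h s. c * U h s)"
proof -
  obtain K where K: "\<And>h s. h \<in> space (hist_space t) \<Longrightarrow> \<bar>U h s\<bar> \<le> K"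
    using bdd_meas_bound[OF assms] by blast
  show ?thesis
  proof (rule admI)
    show "(\<lambda>h. c * U h s) \<in> borel_measurable (hist_space t)" for s
      using borel_measurable_const bdd_meas_measurable[OF assms] by (rule borel_measurable_times)
    show "\<bar>c * U h s\<bar> \<le> \<bar>c\<bar> * K" if "h \<in> space (hist_space t)" for h s
      using K[OF that, of s] by (simp add: abs_mult mult_left_mono)
  qed
qed

lemma bdd_meas_diff: "bdd_meas t U \<Longrightarrow> bdd_meas t W \<Longrightarrow> bdd_meas t (\<lambda>h s. U h s - W h s)"
  using bdd_meas_add[OF _ bdd_meas_cmult[of t W "-1"], of U] by simp

lemma measurable_nu_borel: "(\<lambda>x. x) \<in> measurable \<nu> borel"
  by (subst measurable_cong_sets[OF nu_sets refl]) (auto intro: measurable_restrict_space1)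

text \<open>Joint measurability in history and gain is what makes the integral over the gain a
  measurable function of the history.\<close>

lemma extend_measurable2:
  "(\<lambda>(h, x). h(t := (s, a, j, x))) \<in> measurable (hist_space t \<Otimes>\<^sub>M G p) (hist_space (Suc t))"
proof -
  have id: "(\<lambda>x. x) \<in> measurable (G p) borel"
    using measurable_nu_borel by (simp cong: measurable_cong_sets add: measurable_cong_sets[OF sets_G refl])
  have "(\<lambda>z. (fst z, (s, a, j, snd z))) \<in> measurable (hist_space t \<Otimes>\<^sub>M G p) (hist_space t \<Otimes>\<^sub>M
      (count_space UNIV \<Otimes>\<^sub>M count_space UNIV \<Otimes>\<^sub>M count_space UNIV \<Otimes>\<^sub>M (borel :: real measure)))"
    using measurable_compose[OF measurable_snd id] by (intro measurable_Pair measurable_fst) auto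
  from measurable_compose[OF this[unfolded hist_space_def] measurable_add_dim]
  show ?thesis by (simp add: hist_space_def lessThan_Suc case_prod_beta)
qed

lemma extend_measurable:
  assumes "h \<in> space (hist_space t)"
  shows "(\<lambda>x. h(t := (s, a, j, x))) \<in> measurable \<nu> (hist_space (Suc t))"
proof -
  \<comment> \<open>Any \<open>p\<close> will do: measurability sees only the sigma-algebra, and all
    \<open>G p\<close> share that of \<nu>.\<close>
  fix p
  have "(\<lambda>x. (h, x)) \<in> measurable (G p) (hist_space t \<Otimes>\<^sub>M G p)"
    using assms by (rule measurable_Pair1')
  from measurable_compose[OF this extend_measurable2]
  show ?thesis by (simp add: measurable_cong_sets[OF sets_G refl])
qed

lemma extend_space:
  "h \<in> space (hist_space t) \<Longrightarrow> x \<in> X \<Longrightarrow> h(t := (s, a, j, x)) \<in> space (hist_space (Suc t))"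
  using measurable_space[OF extend_measurable] by (simp add: space_nu)

lemma bdd_meas_extend_measurable:
  assumes "bdd_meas (Suc t) W" "h \<in> space (hist_space t)"
  shows "(\<lambda>x. W (h(t := (s, a, j, x))) s') \<in> borel_measurable \<nu>"
  using measurable_compose[OF extend_measurable[OF assms(2)] bdd_meas_measurable[OF assms(1)]] .

lemma bdd_meas_integrable:
  assumes W: "bdd_meas (Suc t) W" and h: "h \<in> space (hist_space t)" and p: "p \<in> \<Psi>"
  shows "integrable (G p) (\<lambda>x. W (h(t := (s, a, j, x))) s')"
proof -
  interpret prob_space "G p" by (rule prob_space_G[OF p])
  obtain K where "\<And>h s. h \<in> space (hist_space (Suc t)) \<Longrightarrow> \<bar>W h s\<bar> \<le> K"
    using bdd_meas_bound[OF W] by blast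
  then show ?thesis
    using extend_space[OF h] bdd_meas_extend_measurable[OF W h]
    by (intro integrable_const_bound[where B = K]) (auto simp: space_G intro!: AE_I2)
qed

section \<open>The one-step expectation\<close>

definition moves :: "'s \<Rightarrow> (real \<times> nat \<times> 's) set" where
  "moves s = As s \<times> {..<M} \<times> UNIV"

definition weight :: "nat \<Rightarrow> 's hist \<Rightarrow> 's \<Rightarrow> real \<times> nat \<times> 's \<Rightarrow> real" where
  "weight t h s = (\<lambda>(a, j, s'). pmf (L t h s) (a, j) * P s a s')"

text \<open>Conditional expectation of \<open>W\<close> after slot \<open>t\<close>, given the
  history before it and the current state. Powers, channels and states are finite in number, so only
  the gain is integrated; given the power and channel, it is independent of the next state.\<close>

definition step_mean :: "(nat \<Rightarrow> 'p) \<Rightarrow> ('s hist \<Rightarrow> 's \<Rightarrow> real) \<Rightarrow> nat \<Rightarrow> 's hist \<Rightarrow> 's \<Rightarrow> real" where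
  "step_mean \<phi> W t h s = (\<Sum>(a, j, s')\<in>moves s.
     weight t h s (a, j, s') * (\<integral>x. W (h(t := (s, a, j, x))) s' \<partial>G (\<phi> j)))"

lemma moves_iff: "(a, j, s') \<in> moves s \<longleftrightarrow> a \<in> As s \<and> j < M"
  by (auto simp: moves_def)

lemma weight_nonneg: "m \<in> moves s \<Longrightarrow> 0 \<le> weight t h s m"
  by (auto simp: moves_def weight_def P_nonneg)

lemma sum_moves:
  "(\<Sum>m\<in>moves s. weight t h s m * (case m of (a, j, s') \<Rightarrow> f a j s')) =
   (\<Sum>(a, j)\<in>As s \<times> {..<M}. pmf (L t h s) (a, j) * (\<Sum>s'\<in>UNIV. P s a s' * f a j s'))"
  by (simp add: moves_def weight_def sum.cartesian_product' sum_distrib_left mult.assoc)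

lemma sum_moves_choice:
  "(\<Sum>m\<in>moves s. weight t h s m * (case m of (a, j, s') \<Rightarrow> f a j)) =
   (\<Sum>(a, j)\<in>As s \<times> {..<M}. pmf (L t h s) (a, j) * f a j)"
  unfolding sum_moves
  by (intro sum.cong refl) (auto simp: P_sum simp flip: sum_distrib_right)

lemma sum_pmf: "(\<Sum>(a, j)\<in>As s \<times> {..<M}. pmf (L t h s) (a, j)) = 1"
proof -
  have "set_pmf (L t h s) \<subseteq> As s \<times> {..<M}"
    using L_rule by (force simp: is_alloc_rule_def)
  from sum_pmf_eq_1[OF _ this] show ?thesis
    by (simp add: As_fin case_prod_beta)
qed

lemma sum_weight: "(\<Sum>m\<in>moves s. weight t h s m) = 1"
  using sum_moves_choice[where f = "\<lambda>_ _. 1"] sum_pmf by (simp add: case_prod_beta)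

lemma step_mean_mono:
  assumes "params \<phi>" "bdd_meas (Suc t) W" "bdd_meas (Suc t) W'" "h \<in> space (hist_space t)"
    and "\<And>a j x s'. a \<in> As s \<Longrightarrow> j < M \<Longrightarrow> x \<in> X \<Longrightarrow>
      W (h(t := (s, a, j, x))) s' \<le> W' (h(t := (s, a, j, x))) s'"
  shows "step_mean \<phi> W t h s \<le> step_mean \<phi> W' t h s"
  unfolding step_mean_def
  using assms by (intro sum_mono)
    (auto simp: moves_iff space_G intro!: mult_left_mono weight_nonneg integral_mono bdd_meas_integrable paramsD)

lemma step_mean_add:
  assumes "params \<phi>" "bdd_meas (Suc t) W" "bdd_meas (Suc t) W'" "h \<in> space (hist_space t)"
  shows "step_mean \<phi> (\<lambda>h s. W h s + W' h s) t h s = step_mean \<phi> W t h s + step_mean \<phi> W' t h s"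
  unfolding step_mean_def sum.distrib[symmetric]
  using assms
  by (intro sum.cong refl) (auto simp: moves_iff bdd_meas_integrable paramsD distrib_left)

lemma step_mean_cmult: "step_mean \<phi> (\<lambda>h s. c * W h s) t h s = c * step_mean \<phi> W t h s"
  unfolding step_mean_def sum_distrib_left by (intro sum.cong refl) auto

lemma step_mean_move:
  assumes "params \<phi>"
    and "\<And>a j x s'. a \<in> As s \<Longrightarrow> j < M \<Longrightarrow> x \<in> X \<Longrightarrow> W (h(t := (s, a, j, x))) s' = f a j s'"
  shows "step_mean \<phi> W t h s = (\<Sum>m\<in>moves s. weight t h s m * (case m of (a, j, s') \<Rightarrow> f a j s'))"
  unfolding step_mean_def
proof (intro sum.cong refl)
  fix m assume "m \<in> moves s"
  then obtain a j s' where m: "m = (a, j, s')" "a \<in> As s" "j < M" by (auto simp: moves_def)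
  interpret prob_space "G (\<phi> j)" by (rule prob_space_G) (use m assms paramsD in auto)
  have "(\<integral>x. W (h(t := (s, a, j, x))) s' \<partial>G (\<phi> j)) = (\<integral>x. f a j s' \<partial>G (\<phi> j))"
    by (rule Bochner_Integration.integral_cong) (use m assms in \<open>auto simp: space_G\<close>)
  then show "(case m of (a, j, s') \<Rightarrow> weight t h s (a, j, s') * (\<integral>x. W (h(t := (s, a, j, x))) s' \<partial>G (\<phi> j))) =
    weight t h s m * (case m of (a, j, s') \<Rightarrow> f a j s')"
    by (simp add: prob_space m)
qed

lemma step_mean_const: "params \<phi> \<Longrightarrow> step_mean \<phi> (\<lambda>_ _. c) t h s = c"
  by (subst step_mean_move[where f = "\<lambda>_ _ _. c"])
    (auto simp: case_prod_beta sum_weight simp flip: sum_distrib_right)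

lemma bdd_meas_step_mean:
  assumes \<phi>: "params \<phi>" and W: "bdd_meas (Suc t) W"
  shows "bdd_meas t (\<lambda>h s. step_mean \<phi> W t h s)"
proof -
  obtain K where K: "\<forall>h\<in>space (hist_space (Suc t)). \<forall>s. \<bar>W h s\<bar> \<le> K"
    using W unfolding bdd_meas_def by blast
  show ?thesis
  proof (rule admI)
    fix s
    have "(\<lambda>h. \<integral>x. W (h(t := (s, a, j, x))) s' \<partial>G (\<phi> j)) \<in> borel_measurable (hist_space t)"
      if "j < M" for a j s'
    proof -
      interpret prob_space "G (\<phi> j)" by (rule prob_space_G[OF paramsD[OF \<phi> that]])
      show ?thesis
        by (rule borel_measurable_lebesgue_integral)
          (use measurable_compose[OF extend_measurable2 bdd_meas_measurable[OF W]] in \<open>simp add: case_prod_beta\<close>)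
    qed
    moreover have "(\<lambda>h. pmf (L t h s) (a, j)) \<in> borel_measurable (hist_space t)" for a j
      using L_rule by (simp add: is_alloc_rule_def)
    ultimately show "(\<lambda>h. step_mean \<phi> W t h s) \<in> borel_measurable (hist_space t)"
      unfolding step_mean_def weight_def
      by (auto intro!: borel_measurable_sum borel_measurable_times simp: moves_iff split_beta)
  next
    fix h :: "'s hist" and s assume h: "h \<in> space (hist_space t)"
    have "step_mean \<phi> W t h s \<le> step_mean \<phi> (\<lambda>_ _. K) t h s" "step_mean \<phi> (\<lambda>_ _. - K) t h s \<le> step_mean \<phi> W t h s"
      using K extend_space[OF h] by (auto intro!: step_mean_mono \<phi> W h bdd_meas_const simp: abs_le_iff minus_le_iff)
    then show "\<bar>step_mean \<phi> W t h s\<bar> \<le> K" by (simp add: step_mean_const[OF \<phi>])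
  qed
qed

text \<open>Bridge from the nested nonnegative integrals of \<open>exp_cum\<close> to real-valued
  step means. The value of the remaining slots is replaced by a function \<open>E\<close> known to
  be bounded, measurable and nonnegative, so none of this has to be proved of \<open>exp_cum\<close>
  itself.\<close>

lemma exp_cum_step:
  assumes \<phi>: "params \<phi>" and E: "bdd_meas (Suc t) E" and h: "h \<in> space (hist_space t)"
    and E0: "\<And>h s. h \<in> space (hist_space (Suc t)) \<Longrightarrow> 0 \<le> E h s"
    and q0: "\<And>a j x. a \<in> As s \<Longrightarrow> j < M \<Longrightarrow> x \<in> X \<Longrightarrow> 0 \<le> q a j x"
    and qi: "\<And>a j. a \<in> As s \<Longrightarrow> j < M \<Longrightarrow> integrable \<nu> (\<lambda>x. q a j x * g x (\<phi> j))"
  shows "(\<integral>\<^sup>+ aj. (\<integral>\<^sup>+ x. ennreal (g x (\<phi> (snd aj))) * (ennreal (q (fst aj) (snd aj) x) +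
      (\<Sum>s'\<in>UNIV. ennreal (P s (fst aj) s') * ennreal (E (h(t := (s, fst aj, snd aj, x))) s'))) \<partial>\<nu>)
      \<partial>measure_pmf (L t h s))
    = ennreal ((\<Sum>(a, j)\<in>As s \<times> {..<M}. pmf (L t h s) (a, j) * (\<integral>x. q a j x * g x (\<phi> j) \<partial>\<nu>))
        + step_mean \<phi> E t h s)"
proof -
  have supp: "set_pmf (L t h s) \<subseteq> As s \<times> {..<M}"
    using L_rule by (force simp: is_alloc_rule_def)
  define v where "v a j = (\<integral>x. q a j x * g x (\<phi> j) \<partial>\<nu>)
    + (\<Sum>s'\<in>UNIV. P s a s' * (\<integral>x. E (h(t := (s, a, j, x))) s' \<partial>G (\<phi> j)))" for a j
  have inner: "(\<integral>\<^sup>+ x. ennreal (g x (\<phi> j)) * (ennreal (q a j x) +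
      (\<Sum>s'\<in>UNIV. ennreal (P s a s') * ennreal (E (h(t := (s, a, j, x))) s'))) \<partial>\<nu>) = ennreal (v a j)"
    and v0: "0 \<le> v a j" if a: "a \<in> As s" and j: "j < M" for a j
  proof -
    note p = paramsD[OF \<phi> j]
    have Ei: "integrable \<nu> (\<lambda>x. g x (\<phi> j) * E (h(t := (s, a, j, x))) s')" for s'
      using bdd_meas_integrable[OF E h p] integrable_G[OF p bdd_meas_extend_measurable[OF E h]] by simp
    have i: "integrable \<nu> (\<lambda>x. q a j x * g x (\<phi> j)
      + (\<Sum>s'\<in>UNIV. P s a s' * (g x (\<phi> j) * E (h(t := (s, a, j, x))) s')))"
      by (intro Bochner_Integration.integrable_add qi a j Bochner_Integration.integrable_sum
          integrable_mult_right Ei)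
    have nn: "0 \<le> q a j x * g x (\<phi> j)
      + (\<Sum>s'\<in>UNIV. P s a s' * (g x (\<phi> j) * E (h(t := (s, a, j, x))) s'))" if "x \<in> X" for x
      using that a j h
      by (auto intro!: add_nonneg_nonneg sum_nonneg mult_nonneg_nonneg q0 g_nonneg p P_nonneg E0 extend_space)
    have "(\<integral>\<^sup>+ x. ennreal (g x (\<phi> j)) * (ennreal (q a j x) +
        (\<Sum>s'\<in>UNIV. ennreal (P s a s') * ennreal (E (h(t := (s, a, j, x))) s'))) \<partial>\<nu>)
      = (\<integral>\<^sup>+ x. ennreal (q a j x * g x (\<phi> j)
        + (\<Sum>s'\<in>UNIV. P s a s' * (g x (\<phi> j) * E (h(t := (s, a, j, x))) s'))) \<partial>\<nu>)"
    proof (rule nn_integral_cong)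
      fix x assume "x \<in> space \<nu>"
      then have x: "x \<in> X" by (simp add: space_nu)
      have "(\<Sum>s'\<in>UNIV. ennreal (P s a s') * ennreal (E (h(t := (s, a, j, x))) s'))
        = ennreal (\<Sum>s'\<in>UNIV. P s a s' * E (h(t := (s, a, j, x))) s')"
        using a by (subst sum_ennreal[symmetric])
          (auto intro!: mult_nonneg_nonneg P_nonneg E0 extend_space h x sum.cong ennreal_mult'[symmetric])
      then have "ennreal (g x (\<phi> j)) * (ennreal (q a j x) +
        (\<Sum>s'\<in>UNIV. ennreal (P s a s') * ennreal (E (h(t := (s, a, j, x))) s')))
        = ennreal (g x (\<phi> j) * (q a j x + (\<Sum>s'\<in>UNIV. P s a s' * E (h(t := (s, a, j, x))) s')))"
        using a j x g_nonneg[OF p x]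
        by (simp add: ennreal_mult' q0 sum_nonneg P_nonneg E0 extend_space h flip: ennreal_plus)
      then show "ennreal (g x (\<phi> j)) * (ennreal (q a j x) +
        (\<Sum>s'\<in>UNIV. ennreal (P s a s') * ennreal (E (h(t := (s, a, j, x))) s')))
        = ennreal (q a j x * g x (\<phi> j)
          + (\<Sum>s'\<in>UNIV. P s a s' * (g x (\<phi> j) * E (h(t := (s, a, j, x))) s')))"
        by (simp add: distrib_left sum_distrib_left mult_ac)
    qed
    also have "\<dots> = ennreal (\<integral>x. q a j x * g x (\<phi> j)
        + (\<Sum>s'\<in>UNIV. P s a s' * (g x (\<phi> j) * E (h(t := (s, a, j, x))) s')) \<partial>\<nu>)"
      using nn by (intro nn_integral_eq_integral i AE_I2) (simp add: space_nu)
    also have eq: "(\<integral>x. q a j x * g x (\<phi> j)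
        + (\<Sum>s'\<in>UNIV. P s a s' * (g x (\<phi> j) * E (h(t := (s, a, j, x))) s')) \<partial>\<nu>) = v a j"
      using qi[OF a j] Ei
      by (simp add: v_def integral_G[OF p bdd_meas_extend_measurable[OF E h]])
    finally show "(\<integral>\<^sup>+ x. ennreal (g x (\<phi> j)) * (ennreal (q a j x) +
      (\<Sum>s'\<in>UNIV. ennreal (P s a s') * ennreal (E (h(t := (s, a, j, x))) s'))) \<partial>\<nu>) = ennreal (v a j)" .
    show "0 \<le> v a j"
      unfolding eq[symmetric] using nn by (intro integral_nonneg_AE AE_I2) (simp add: space_nu)
  qed
  have "(\<integral>\<^sup>+ aj. (\<integral>\<^sup>+ x. ennreal (g x (\<phi> (snd aj))) * (ennreal (q (fst aj) (snd aj) x) +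
      (\<Sum>s'\<in>UNIV. ennreal (P s (fst aj) s') * ennreal (E (h(t := (s, fst aj, snd aj, x))) s'))) \<partial>\<nu>)
      \<partial>measure_pmf (L t h s))
    = (\<integral>\<^sup>+ aj. ennreal (v (fst aj) (snd aj)) \<partial>measure_pmf (L t h s))"
    using supp by (intro nn_integral_cong_AE) (auto simp: AE_measure_pmf_iff intro!: inner)
  also have "\<dots> = (\<Sum>aj\<in>As s \<times> {..<M}. ennreal (v (fst aj) (snd aj)) * ennreal (pmf (L t h s) aj))"
    using supp by (intro nn_integral_measure_pmf_support) (auto simp: As_fin)
  also have "\<dots> = (\<Sum>aj\<in>As s \<times> {..<M}. ennreal (pmf (L t h s) aj * v (fst aj) (snd aj)))"
    by (intro sum.cong refl) (auto simp: ennreal_mult' v0 mult.commute)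
  also have "\<dots> = ennreal (\<Sum>aj\<in>As s \<times> {..<M}. pmf (L t h s) aj * v (fst aj) (snd aj))"
    by (intro sum_ennreal) (auto simp: v0)
  also have "(\<Sum>aj\<in>As s \<times> {..<M}. pmf (L t h s) aj * v (fst aj) (snd aj))
    = (\<Sum>(a, j)\<in>As s \<times> {..<M}. pmf (L t h s) (a, j) * (\<integral>x. q a j x * g x (\<phi> j) \<partial>\<nu>)) + step_mean \<phi> E t h s"
  proof -
    have "step_mean \<phi> E t h s = (\<Sum>(a, j)\<in>As s \<times> {..<M}. pmf (L t h s) (a, j) *
        (\<Sum>s'\<in>UNIV. P s a s' * (\<integral>x. E (h(t := (s, a, j, x))) s' \<partial>G (\<phi> j))))"
      unfolding sum_moves[symmetric] step_mean_def by (intro sum.cong refl) auto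
    then show ?thesis by (simp add: v_def case_prod_beta distrib_left sum.distrib)
  qed
  finally show ?thesis .
qed

end

section \<open>Change of measure, regret and visits\<close>

lemma exp_quadratic_bound:
  fixes x :: real
  assumes "\<bar>x\<bar> \<le> 1"
  shows "exp x \<le> 1 + x + x\<^sup>2"
proof (cases "x \<ge> 0")
  case True
  then show ?thesis using assms exp_bound[of x] by simp
next
  case False
  \<comment> \<open>For negative \<open>x\<close> the exponential is at most
    \<open>1 / (1 - x)\<close>, and the identity shows that the quadratic dominates this
    fraction.\<close>
  have "(1 - x) * (1 + x + x\<^sup>2) = 1 - x * x\<^sup>2" by (simp add: algebra_simps power2_eq_square)
  moreover have "x * x\<^sup>2 \<le> 0" using False by (simp add: mult_le_0_iff)
  ultimately have "1 / (1 - x) \<le> 1 + x + x\<^sup>2" using False by (simp add: field_simps)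
  moreover have "exp x \<le> 1 / (1 - x)"
    using False exp_ge_add_one_self[of "- x"] by (simp add: exp_minus field_simps)
  ultimately show ?thesis by simp
qed

text \<open>A predicate on state and channel covers the three counts in play: uses of channel
  \<open>i\<close>, visits to \<open>z\<close>, and choices other than \<open>i\<close> made in
  \<open>z\<close>.\<close>

definition visit_count :: "('s \<Rightarrow> nat \<Rightarrow> bool) \<Rightarrow> nat \<Rightarrow> 's hist \<Rightarrow> real" where
  "visit_count p t h = (\<Sum>k<t. of_bool (p (fst (h k)) (fst (snd (snd (h k))))))"

lemma visit_count_extend: "visit_count p (Suc t) (h(t := (s, a, j, x))) = visit_count p t h + of_bool (p s j)"
  by (simp add: visit_count_def)

lemma visit_count_0 [simp]: "visit_count p 0 h = 0"
  by (simp add: visit_count_def)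

lemma visit_count_nonneg: "0 \<le> visit_count p t h"
  by (simp add: visit_count_def sum_nonneg)

lemma visit_count_le: "visit_count p t h \<le> real t"
  using sum_mono[of "{..<t}" "\<lambda>k. of_bool (p (fst (h k)) (fst (snd (snd (h k)))))" "\<lambda>_. 1 :: real"]
  by (simp add: visit_count_def)

lemma visit_count_measurable: "visit_count p t \<in> borel_measurable (hist_space t :: ('s::finite) hist measure)"
proof -
  have "(\<lambda>h. of_bool (p (fst (h k)) (fst (snd (snd (h k))))) :: real)
      \<in> borel_measurable (hist_space t :: 's hist measure)" if "k < t" for k
  proof -
    let ?N = "count_space (UNIV :: 's set) \<Otimes>\<^sub>M count_space (UNIV :: real set) \<Otimes>\<^sub>M
      count_space (UNIV :: nat set) \<Otimes>\<^sub>M (borel :: real measure)"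
    have h: "(\<lambda>h. h k) \<in> measurable (hist_space t) ?N"
      unfolding hist_space_def using that by (intro measurable_component_singleton) simp
    \<comment> \<open>Dropping the power and the gain leaves a pair of countable components, whose
      product sigma-algebra is discrete. Hence an arbitrary \<open>p\<close> is allowed.\<close>
    have "(\<lambda>z. (fst z, fst (snd (snd z))))
        \<in> measurable ?N (count_space (UNIV :: 's set) \<Otimes>\<^sub>M count_space (UNIV :: nat set))"
      by measurable
    then have z: "(\<lambda>z. (fst z, fst (snd (snd z))))
        \<in> measurable ?N (count_space (UNIV :: ('s \<times> nat) set))"
      by (subst (asm) pair_measure_countable) (auto intro: countable_finite)
    have "(\<lambda>y. of_bool (p (fst y) (snd y)) :: real) \<in> borel_measurable (count_space UNIV)"
      by simp
    from measurable_compose[OF measurable_compose[OF h z] this] show ?thesis by simp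
  qed
  then show ?thesis unfolding visit_count_def[abs_def] by (intro borel_measurable_sum) auto
qed

context bandit
begin

section \<open>Expectations over several slots\<close>

lemma bdd_meas_visit_count: "bdd_meas t (\<lambda>h s. visit_count p t h)"
  by (intro admI[where K = "real t"] visit_count_measurable) (simp add: visit_count_nonneg visit_count_le)

lemma bdd_meas_exp:
  assumes "bdd_meas t W"
  shows "bdd_meas t (\<lambda>h s. exp (W h s))"
proof -
  obtain K where "\<forall>h\<in>space (hist_space t). \<forall>s. \<bar>W h s\<bar> \<le> K" using assms unfolding bdd_meas_def by blast
  then show ?thesis
    by (intro admI[where K = "exp K"])
      (auto intro!: borel_measurable_exp[THEN measurable_compose[rotated]] bdd_meas_measurable[OF assms]
        simp: abs_le_iff)
qed

lemma bdd_meas_ln: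
  assumes "bdd_meas t W" "\<And>h s. h \<in> space (hist_space t) \<Longrightarrow> 1 \<le> W h s"
  shows "bdd_meas t (\<lambda>h s. ln (W h s))"
proof -
  obtain K where K: "\<forall>h\<in>space (hist_space t). \<forall>s. \<bar>W h s\<bar> \<le> K" using assms(1) unfolding bdd_meas_def by blast
  show ?thesis
  proof (rule admI[where K = "ln K"])
    show "(\<lambda>h. ln (W h s)) \<in> borel_measurable (hist_space t)" for s
      using bdd_meas_measurable[OF assms(1)] by (rule borel_measurable_ln)
    fix h :: "'s hist" and s assume "h \<in> space (hist_space t)"
    with assms(2)[of h s] K have "1 \<le> W h s" "W h s \<le> K" by (auto simp: abs_le_iff)
    then show "\<bar>ln (W h s)\<bar> \<le> ln K" by simp
  qed
qed

text \<open>\<open>F\<close> reads the whole history at the end of the \<open>n\<close> slots, which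
  has length \<open>t + n\<close>; this is why boundedness is always assumed at that index.\<close>

primrec path_mean :: "(nat \<Rightarrow> 'p) \<Rightarrow> ('s hist \<Rightarrow> real) \<Rightarrow> nat \<Rightarrow> nat \<Rightarrow> 's hist \<Rightarrow> 's \<Rightarrow> real" where
  "path_mean \<phi> F 0 = (\<lambda>t h s. F h)"
| "path_mean \<phi> F (Suc n) = (\<lambda>t h s. step_mean \<phi> (path_mean \<phi> F n (Suc t)) t h s)"

lemma bdd_meas_path_mean:
  assumes "params \<phi>" "bdd_meas (t + n) (\<lambda>h s. F h)"
  shows "bdd_meas t (\<lambda>h s. path_mean \<phi> F n t h s)"
  using assms(2)
proof (induction n arbitrary: t)
  case (Suc n)
  then show ?case using bdd_meas_step_mean[OF assms(1)] by simp
qed simp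

lemma path_mean_mono:
  assumes "params \<phi>" "bdd_meas (t + n) (\<lambda>h s. F h)" "bdd_meas (t + n) (\<lambda>h s. F' h)"
    and "\<And>h. h \<in> space (hist_space (t + n)) \<Longrightarrow> F h \<le> F' h" "h \<in> space (hist_space t)"
  shows "path_mean \<phi> F n t h s \<le> path_mean \<phi> F' n t h s"
  using assms(2-)
proof (induction n arbitrary: t h s)
  case (Suc n)
  have "path_mean \<phi> F n (Suc t) h s \<le> path_mean \<phi> F' n (Suc t) h s" if "h \<in> space (hist_space (Suc t))" for h s
    using Suc.IH[of "Suc t"] Suc.prems that by simp
  then show ?case using Suc.prems by (auto intro!: step_mean_mono assms(1) bdd_meas_path_mean extend_space)
qed simp

lemma step_mean_cong:
  assumes "params \<phi>" "h \<in> space (hist_space t)"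
    and "\<And>h s. h \<in> space (hist_space (Suc t)) \<Longrightarrow> W h s = W' h s"
  shows "step_mean \<phi> W t h s = step_mean \<phi> W' t h s"
  unfolding step_mean_def
  by (intro sum.cong refl)
    (auto simp: space_G assms(3) extend_space[OF assms(2)] intro!: arg_cong2[where f = "(*)"] Bochner_Integration.integral_cong)

lemma path_mean_add:
  assumes "params \<phi>" "bdd_meas (t + n) (\<lambda>h s. F h)" "bdd_meas (t + n) (\<lambda>h s. F' h)" "h \<in> space (hist_space t)"
  shows "path_mean \<phi> (\<lambda>h. F h + F' h) n t h s = path_mean \<phi> F n t h s + path_mean \<phi> F' n t h s"
  using assms(2-)
proof (induction n arbitrary: t h s)
  case (Suc n)
  have "step_mean \<phi> (path_mean \<phi> (\<lambda>h. F h + F' h) n (Suc t)) t h s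
    = step_mean \<phi> (\<lambda>h s. path_mean \<phi> F n (Suc t) h s + path_mean \<phi> F' n (Suc t) h s) t h s"
    using Suc by (intro step_mean_cong assms(1)) auto
  then show ?case using Suc.prems by (simp add: step_mean_add assms(1) bdd_meas_path_mean)
qed simp

lemma path_mean_cmult:
  assumes "params \<phi>" "h \<in> space (hist_space t)"
  shows "path_mean \<phi> (\<lambda>h. c * F h) n t h s = c * path_mean \<phi> F n t h s"
  using assms(2-)
proof (induction n arbitrary: t h s)
  case (Suc n)
  have "step_mean \<phi> (path_mean \<phi> (\<lambda>h. c * F h) n (Suc t)) t h s = step_mean \<phi> (\<lambda>h s. c * path_mean \<phi> F n (Suc t) h s) t h s"
    using Suc by (intro step_mean_cong assms(1)) auto
  then show ?case by (simp add: step_mean_cmult)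
qed simp

lemma path_mean_const:
  assumes "params \<phi>" "h \<in> space (hist_space t)"
  shows "path_mean \<phi> (\<lambda>h. c) n t h s = c"
  using assms(2-)
proof (induction n arbitrary: t h s)
  case (Suc n)
  have "step_mean \<phi> (path_mean \<phi> (\<lambda>h. c) n (Suc t)) t h s = step_mean \<phi> (\<lambda>h s. c) t h s"
    using Suc by (intro step_mean_cong assms(1)) auto
  then show ?case by (simp add: step_mean_const assms(1))
qed simp

text \<open>Visits already recorded in \<open>h\<close> are subtracted, so that the recursion agrees
  with that of \<open>exp_cum\<close>, which counts future slots only.\<close>

definition mean_count :: "(nat \<Rightarrow> 'p) \<Rightarrow> ('s \<Rightarrow> nat \<Rightarrow> bool) \<Rightarrow> nat \<Rightarrow> nat \<Rightarrow> 's hist \<Rightarrow> 's \<Rightarrow> real" where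
  "mean_count \<phi> p n t h s = path_mean \<phi> (visit_count p (t + n)) n t h s - visit_count p t h"

lemma mean_count_0 [simp]: "mean_count \<phi> p 0 t h s = 0"
  by (simp add: mean_count_def)

lemma bdd_meas_mean_count: "params \<phi> \<Longrightarrow> bdd_meas t (\<lambda>h s. mean_count \<phi> p n t h s)"
  unfolding mean_count_def by (intro bdd_meas_diff bdd_meas_path_mean bdd_meas_visit_count)

lemma mean_count_Suc:
  assumes \<phi>: "params \<phi>" and h: "h \<in> space (hist_space t)"
  shows "mean_count \<phi> p (Suc n) t h s =
    (\<Sum>(a, j)\<in>As s \<times> {..<M}. pmf (L t h s) (a, j) * of_bool (p s j)) + step_mean \<phi> (\<lambda>h s. mean_count \<phi> p n (Suc t) h s) t h s"
proof -
  have 1: "step_mean \<phi> (\<lambda>h s. visit_count p (Suc t) h) t h s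
    = (\<Sum>m\<in>moves s. weight t h s m * (case m of (a, j, s') \<Rightarrow> visit_count p t h + of_bool (p s j)))"
    by (rule step_mean_move[OF \<phi>]) (simp add: visit_count_extend)
  have "\<dots> = visit_count p t h + (\<Sum>(a, j)\<in>As s \<times> {..<M}. pmf (L t h s) (a, j) * of_bool (p s j))"
    unfolding sum_moves_choice
    using sum_pmf[of t h s]
    by (simp add: case_prod_beta distrib_left sum.distrib flip: sum_distrib_right)
  with 1 have 1: "step_mean \<phi> (\<lambda>h s. visit_count p (Suc t) h) t h s
      = visit_count p t h + (\<Sum>(a, j)\<in>As s \<times> {..<M}. pmf (L t h s) (a, j) * of_bool (p s j))" by simp
  have "mean_count \<phi> p (Suc n) t h s + visit_count p t h
      = step_mean \<phi> (\<lambda>h s. mean_count \<phi> p n (Suc t) h s + visit_count p (Suc t) h) t h s"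
    by (simp add: mean_count_def)
  also have "\<dots> = step_mean \<phi> (\<lambda>h s. mean_count \<phi> p n (Suc t) h s) t h s + step_mean \<phi> (\<lambda>h s. visit_count p (Suc t) h) t h s"
    by (rule step_mean_add[OF \<phi> bdd_meas_mean_count[OF \<phi>] bdd_meas_visit_count h])
  finally show ?thesis using 1 by simp
qed

lemma mean_count_nonneg:
  assumes "params \<phi>" "h \<in> space (hist_space t)"
  shows "0 \<le> mean_count \<phi> p n t h s"
  using assms(2)
proof (induction n arbitrary: t h s)
  case (Suc n)
  have "step_mean \<phi> (\<lambda>_ _. 0) t h s \<le> step_mean \<phi> (\<lambda>h s. mean_count \<phi> p n (Suc t) h s) t h s"
    using Suc by (intro step_mean_mono assms(1) bdd_meas_const bdd_meas_mean_count) (auto intro: extend_space)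
  moreover have "0 \<le> (\<Sum>(a, j)\<in>As s \<times> {..<M}. pmf (L t h s) (a, j) * of_bool (p s j))"
    by (auto intro: sum_nonneg)
  ultimately show ?case using Suc.prems by (simp add: mean_count_Suc assms(1) step_mean_const)
qed simp

text \<open>Monotonicity of the nonnegative integral asks for no measurability, so a pointwise bound
  on \<open>exp_cum\<close> suffices. Rewards need only such an upper bound, as regret is to be
  bounded below; uses of a channel are computed exactly with the companion equality.\<close>

lemma exp_cum_Suc_le:
  assumes \<phi>: "params \<phi>" and E: "bdd_meas (Suc t) E" and h: "h \<in> space (hist_space t)"
    and E0: "\<And>h s. h \<in> space (hist_space (Suc t)) \<Longrightarrow> 0 \<le> E h s"
    and q0: "\<And>a j x. a \<in> As s \<Longrightarrow> j < M \<Longrightarrow> x \<in> X \<Longrightarrow> 0 \<le> q a j x"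
    and qi: "\<And>a j. a \<in> As s \<Longrightarrow> j < M \<Longrightarrow> integrable \<nu> (\<lambda>x. q a j x * g x (\<phi> j))"
    and le: "\<And>h s. h \<in> space (hist_space (Suc t)) \<Longrightarrow> exp_cum L P \<nu> g \<phi> q n (Suc t) h s \<le> ennreal (E h s)"
  shows "exp_cum L P \<nu> g \<phi> q (Suc n) t h s
    \<le> ennreal ((\<Sum>(a, j)\<in>As s \<times> {..<M}. pmf (L t h s) (a, j) * (\<integral>x. q a j x * g x (\<phi> j) \<partial>\<nu>))
        + step_mean \<phi> E t h s)"
  unfolding exp_cum.simps
  by (rule order_trans[rotated], rule eq_refl, rule exp_cum_step[OF \<phi> E h], erule E0,
      erule (2) q0, erule (1) qi, intro nn_integral_mono mult_left_mono add_left_mono sum_mono le)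
    (auto simp: space_nu intro: extend_space h)

lemma exp_cum_Suc_eq:
  assumes \<phi>: "params \<phi>" and E: "bdd_meas (Suc t) E" and h: "h \<in> space (hist_space t)"
    and E0: "\<And>h s. h \<in> space (hist_space (Suc t)) \<Longrightarrow> 0 \<le> E h s"
    and q0: "\<And>a j x. a \<in> As s \<Longrightarrow> j < M \<Longrightarrow> x \<in> X \<Longrightarrow> 0 \<le> q a j x"
    and qi: "\<And>a j. a \<in> As s \<Longrightarrow> j < M \<Longrightarrow> integrable \<nu> (\<lambda>x. q a j x * g x (\<phi> j))"
    and eq: "\<And>h s. h \<in> space (hist_space (Suc t)) \<Longrightarrow> exp_cum L P \<nu> g \<phi> q n (Suc t) h s = ennreal (E h s)"
  shows "exp_cum L P \<nu> g \<phi> q (Suc n) t h s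
    = ennreal ((\<Sum>(a, j)\<in>As s \<times> {..<M}. pmf (L t h s) (a, j) * (\<integral>x. q a j x * g x (\<phi> j) \<partial>\<nu>))
        + step_mean \<phi> E t h s)"
  unfolding exp_cum.simps
  by (rule trans[rotated], rule exp_cum_step[OF \<phi> E h], erule E0, erule (2) q0, erule (1) qi, intro nn_integral_cong arg_cong2[where f = "(*)"] arg_cong2[where f = "(+)"] sum.cong refl eq)
    (auto simp: space_nu intro: extend_space h)

lemma exp_cum_uses:
  assumes \<phi>: "params \<phi>" and h: "h \<in> space (hist_space t)"
  shows "exp_cum L P \<nu> g \<phi> (\<lambda>a j x. if j = i then 1 else 0) n t h s
    = ennreal (mean_count \<phi> (\<lambda>_ j. j = i) n t h s)"
  using h
proof (induction n arbitrary: t h s)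
  case (Suc n)
  have "integrable \<nu> (\<lambda>x. (if j = i then 1 else 0) * g x (\<phi> j))" if "j < M" for j
    using integrable_g[OF paramsD[OF \<phi> that]] by simp
  moreover have "(\<integral>x. (if j = i then 1 else 0) * g x (\<phi> j) \<partial>\<nu>) = of_bool (j = i)" if "j < M" for j
    using integral_g[OF paramsD[OF \<phi> that]] by simp
  ultimately show ?case
    by (subst exp_cum_Suc_eq[where E = "\<lambda>h s. mean_count \<phi> (\<lambda>_ j. j = i) n (Suc t) h s"])
      (auto simp: mean_count_Suc[OF \<phi> Suc.prems] Suc bdd_meas_mean_count mean_count_nonneg \<phi> intro!: sum.cong arg_cong[where f = ennreal])
qed simp

text \<open>\<open>p\<close> marks choices that miss Bellman optimality by at least \<open>D\<close>: every such choice
  costs \<open>D\<close> in regret.\<close>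

lemma exp_cum_bellman:
  assumes \<phi>: "params \<phi>" and h: "h \<in> space (hist_space t)"
    and q0: "\<And>s a j x. a \<in> As s \<Longrightarrow> j < M \<Longrightarrow> x \<in> X \<Longrightarrow> 0 \<le> q a j x"
    and qi: "\<And>s a j. a \<in> As s \<Longrightarrow> j < M \<Longrightarrow> integrable \<nu> (\<lambda>x. q a j x * g x (\<phi> j))"
    and bell: "\<And>s a j. a \<in> As s \<Longrightarrow> j < M \<Longrightarrow> (\<integral>x. q a j x * g x (\<phi> j) \<partial>\<nu>) + D * of_bool (p s j)
      + (\<Sum>s'\<in>UNIV. P s a s' * b s') \<le> \<rho> + b s"
    and C: "\<And>s. 0 \<le> b s + C"
  shows "exp_cum L P \<nu> g \<phi> q n t h s \<le> ennreal (real n * \<rho> + b s + C - D * mean_count \<phi> p n t h s)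
    \<and> 0 \<le> real n * \<rho> + b s + C - D * mean_count \<phi> p n t h s"
  using h
proof (induction n arbitrary: t h s)
  case 0
  then show ?case using C by simp
next
  case (Suc n)
  \<comment> \<open>The shift \<open>C\<close> keeps this bound nonnegative, so that
    \<open>ennreal\<close> does not cut it off. Nonnegativity is part of the induction because
    \<open>exp_cum_Suc_le\<close> requires it of \<open>E\<close>.\<close>
  define E where "E h s = real n * \<rho> + b s + C - D * mean_count \<phi> p n (Suc t) h s" for h s
  let ?S = "As s \<times> {..<M}"
  define w where "w = pmf (L t h s)"
  have E: "bdd_meas (Suc t) E"
    unfolding E_def using bdd_meas_diff[OF bdd_meas_const[of _ "\<lambda>s. real n * \<rho> + b s + C"] bdd_meas_cmult[OF bdd_meas_mean_count[OF \<phi>]]]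
    by simp
  have E0: "0 \<le> E h s" if "h \<in> space (hist_space (Suc t))" for h s
    using Suc.IH[OF that] by (simp add: E_def)
  have m0: "0 \<le> (\<integral>x. q a j x * g x (\<phi> j) \<partial>\<nu>)" if "a \<in> As s" "j < M" for a j
    using that q0 g_nonneg paramsD[OF \<phi>]
    by (intro integral_nonneg_AE AE_I2) (auto simp: space_nu)
  have le: "exp_cum L P \<nu> g \<phi> q (Suc n) t h s
    \<le> ennreal ((\<Sum>(a, j)\<in>?S. w (a, j) * (\<integral>x. q a j x * g x (\<phi> j) \<partial>\<nu>)) + step_mean \<phi> E t h s)"
    unfolding w_def
    using Suc.IH q0 qi by (intro exp_cum_Suc_le \<phi> E Suc.prems E0) (auto simp: E_def)
  have "step_mean \<phi> E t h s = step_mean \<phi> (\<lambda>h s. (real n * \<rho> + C + b s) + (- D) * mean_count \<phi> p n (Suc t) h s) t h s"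
    by (simp add: E_def[abs_def] algebra_simps)
  also have "\<dots> = step_mean \<phi> (\<lambda>h s. real n * \<rho> + C + b s) t h s - D * step_mean \<phi> (\<lambda>h s. mean_count \<phi> p n (Suc t) h s) t h s"
    by (subst step_mean_add) (auto intro!: \<phi> Suc.prems bdd_meas_const bdd_meas_cmult[of _ _ "- D", simplified] bdd_meas_mean_count simp: step_mean_cmult[of _ "- D", simplified])
  also have "step_mean \<phi> (\<lambda>h s. real n * \<rho> + C + b s) t h s
    = (\<Sum>(a, j)\<in>?S. w (a, j) * (\<Sum>s'\<in>UNIV. P s a s' * (real n * \<rho> + C + b s')))"
    unfolding w_def sum_moves[symmetric] by (rule step_mean_move[OF \<phi>]) simp
  also have "\<dots> = (\<Sum>(a, j)\<in>?S. w (a, j) * (real n * \<rho> + C + (\<Sum>s'\<in>UNIV. P s a s' * b s')))"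
    by (intro sum.cong refl) (auto simp: distrib_left sum.distrib P_sum simp flip: sum_distrib_right)
  finally have stpE: "step_mean \<phi> E t h s =
      (\<Sum>(a, j)\<in>?S. w (a, j) * (real n * \<rho> + C + (\<Sum>s'\<in>UNIV. P s a s' * b s')))
      - D * step_mean \<phi> (\<lambda>h s. mean_count \<phi> p n (Suc t) h s) t h s" .
  have "(\<Sum>(a, j)\<in>?S. w (a, j) * (\<integral>x. q a j x * g x (\<phi> j) \<partial>\<nu>))
      + (\<Sum>(a, j)\<in>?S. w (a, j) * (real n * \<rho> + C + (\<Sum>s'\<in>UNIV. P s a s' * b s')))
      + D * (\<Sum>(a, j)\<in>?S. w (a, j) * of_bool (p s j))
    = (\<Sum>(a, j)\<in>?S. w (a, j) * ((\<integral>x. q a j x * g x (\<phi> j) \<partial>\<nu>) + D * of_bool (p s j)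
      + (\<Sum>s'\<in>UNIV. P s a s' * b s') + (real n * \<rho> + C)))"
    by (simp add: case_prod_beta sum_distrib_left sum.distrib[symmetric] algebra_simps)
  also have "\<dots> \<le> (\<Sum>(a, j)\<in>?S. w (a, j) * (\<rho> + b s + (real n * \<rho> + C)))"
    unfolding case_prod_beta by (intro sum_mono mult_left_mono add_right_mono bell) (auto simp: w_def)
  also have "\<dots> = \<rho> + b s + (real n * \<rho> + C)"
    using sum_pmf[of t h s] by (simp add: w_def case_prod_beta flip: sum_distrib_right)
  finally have bound: "(\<Sum>(a, j)\<in>?S. w (a, j) * (\<integral>x. q a j x * g x (\<phi> j) \<partial>\<nu>)) + step_mean \<phi> E t h s
    \<le> real (Suc n) * \<rho> + b s + C - D * mean_count \<phi> p (Suc n) t h s"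
    unfolding stpE by (simp add: mean_count_Suc[OF \<phi> Suc.prems] w_def algebra_simps)
  have "step_mean \<phi> (\<lambda>_ _. 0) t h s \<le> step_mean \<phi> E t h s"
    using Suc.prems by (intro step_mean_mono \<phi> E bdd_meas_const E0 extend_space) auto
  then have "0 \<le> (\<Sum>(a, j)\<in>?S. w (a, j) * (\<integral>x. q a j x * g x (\<phi> j) \<partial>\<nu>)) + step_mean \<phi> E t h s"
    by (auto simp: step_mean_const[OF \<phi>] w_def intro!: add_nonneg_nonneg sum_nonneg mult_nonneg_nonneg m0)
  with bound order_trans[OF le ennreal_leI[OF bound]] show ?case by linarith
qed

text \<open>Chain rule of relative entropy in dual form. The choice and transition probabilities and
  the gains of all other channels have the same law under both vectors, so only slots that use
  channel \<open>i\<close> are charged, each with one \<open>KL\<close>.\<close>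

lemma change_of_measure:
  assumes \<phi>: "params \<phi>" and \<phi>': "params \<phi>'" and i: "i < M"
    and same: "\<And>j. j < M \<Longrightarrow> j \<noteq> i \<Longrightarrow> \<phi>' j = \<phi> j"
    and kl: "kl_finite \<nu> g (\<phi> i) (\<phi>' i)"
    and F: "bdd_meas (t + n) (\<lambda>h s. F h)" and F0: "\<And>h. 0 \<le> F h"
    and h: "h \<in> space (hist_space t)"
  shows "path_mean \<phi> F n t h s \<le> ln (path_mean \<phi>' (\<lambda>h. exp (F h)) n t h s)
    + KL \<nu> g (\<phi> i) (\<phi>' i) * mean_count \<phi> (\<lambda>_ j. j = i) n t h s"
  using F h
proof (induction n arbitrary: t h s)
  case 0
  then show ?case by simp
next
  case (Suc n)
  define I where "I = KL \<nu> g (\<phi> i) (\<phi>' i)"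
  define U where "U = path_mean \<phi>' (\<lambda>h. exp (F h)) n (Suc t)"
  define N where "N = mean_count \<phi> (\<lambda>_ j. j = i) n (Suc t)"
  have F: "bdd_meas (Suc t + n) (\<lambda>h s. F h)" using Suc.prems by simp
  have U: "bdd_meas (Suc t) U"
    unfolding U_def using bdd_meas_path_mean[OF \<phi>' bdd_meas_exp[OF F]] by simp
  have N: "bdd_meas (Suc t) N" unfolding N_def using bdd_meas_mean_count[OF \<phi>] by simp
  \<comment> \<open>Nonnegativity of \<open>F\<close> enters here: it keeps \<open>U\<close> at
    least 1 and thus \<open>ln U\<close> bounded.\<close>
  have U1: "1 \<le> U h s" if "h \<in> space (hist_space (Suc t))" for h s
  proof -
    have "path_mean \<phi>' (\<lambda>_. 1) n (Suc t) h s \<le> U h s"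
      unfolding U_def using F0 by (intro path_mean_mono \<phi>' bdd_meas_const bdd_meas_exp F that) simp
    then show ?thesis using that by (simp add: path_mean_const[OF \<phi>'])
  qed
  obtain K where K: "\<forall>h\<in>space (hist_space (Suc t)). \<forall>s. \<bar>U h s\<bar> \<le> K"
    using U unfolding bdd_meas_def by blast
  \<comment> \<open>Tangent point for the logarithm. As \<open>c\<close> is the mean of
    \<open>U\<close> over the whole step, the terms \<open>U / c\<close> average to exactly 1 and
    cancel the \<open>- 1\<close>, which leaves \<open>ln c\<close>.\<close>
  define c where "c = step_mean \<phi>' U t h s"
  have "step_mean \<phi>' (\<lambda>_ _. 1) t h s \<le> c"
    unfolding c_def using Suc.prems by (intro step_mean_mono \<phi>' U bdd_meas_const U1 extend_space) auto
  then have c1: "1 \<le> c" by (simp add: step_mean_const[OF \<phi>'])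
  have lnU: "bdd_meas (Suc t) (\<lambda>h s. ln (U h s))" using U U1 by (rule bdd_meas_ln)
  have step: "(\<integral>x. ln (U (h(t := (s, a, j, x))) s') \<partial>G (\<phi> j))
      \<le> (\<integral>x. U (h(t := (s, a, j, x))) s' \<partial>G (\<phi>' j)) / c - 1 + ln c + I * of_bool (j = i)"
    if "a \<in> As s" "j < M" for a j s'
  proof (cases "j = i")
    case True
    have "(\<integral>x. ln (U (h(t := (s, a, j, x))) s') \<partial>G (\<phi> j))
      \<le> (\<integral>x. U (h(t := (s, a, j, x))) s' \<partial>G (\<phi>' j)) / c - 1 + ln c + KL \<nu> g (\<phi> j) (\<phi>' j)"
      using that kl c1 K True U1 extend_space[OF Suc.prems(2)]
      by (intro integral_ln_le_KL[where K = K] paramsD[OF \<phi>] paramsD[OF \<phi>']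
          bdd_meas_extend_measurable[OF U Suc.prems(2)]) (auto simp: abs_le_iff)
    with True show ?thesis by (simp add: I_def)
  next
    case False
    then have eq: "\<phi>' j = \<phi> j" using same that by simp
    interpret prob_space "G (\<phi> j)" by (rule prob_space_G[OF paramsD[OF \<phi> that(2)]])
    note int = bdd_meas_integrable[OF U Suc.prems(2) paramsD[OF \<phi> that(2)], of s a j s']
    have "(\<integral>x. ln (U (h(t := (s, a, j, x))) s') \<partial>G (\<phi> j))
        \<le> (\<integral>x. U (h(t := (s, a, j, x))) s' / c - 1 + ln c \<partial>G (\<phi> j))"
    proof (rule integral_mono)
      show "integrable (G (\<phi> j)) (\<lambda>x. ln (U (h(t := (s, a, j, x))) s'))"
        by (rule bdd_meas_integrable[OF lnU Suc.prems(2) paramsD[OF \<phi> that(2)]])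
      show "integrable (G (\<phi> j)) (\<lambda>x. U (h(t := (s, a, j, x))) s' / c - 1 + ln c)"
        using int by simp
      fix x assume "x \<in> space (G (\<phi> j))"
      then have "1 \<le> U (h(t := (s, a, j, x))) s'"
        by (intro U1 extend_space Suc.prems) (simp add: space_G)
      then show "ln (U (h(t := (s, a, j, x))) s') \<le> U (h(t := (s, a, j, x))) s' / c - 1 + ln c"
        using ln_le_minus_one[of "U (h(t := (s, a, j, x))) s' / c"] c1 by (simp add: ln_div)
    qed
    also have "\<dots> = (\<integral>x. U (h(t := (s, a, j, x))) s' \<partial>G (\<phi>' j)) / c - 1 + ln c"
      using int by (simp add: eq prob_space)
    finally show ?thesis using False by simp
  qed
  have "path_mean \<phi> F (Suc n) t h s \<le> step_mean \<phi> (\<lambda>h s. ln (U h s) + I * N h s) t h s"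
    unfolding path_mean.simps U_def N_def I_def
    using F Suc.prems
    by (intro step_mean_mono \<phi> bdd_meas_add bdd_meas_cmult bdd_meas_path_mean Suc.IH lnU[unfolded U_def] N[unfolded N_def] extend_space) auto
  also have "\<dots> = step_mean \<phi> (\<lambda>h s. ln (U h s)) t h s + I * step_mean \<phi> N t h s"
    using lnU N Suc.prems by (simp add: step_mean_add[OF \<phi>] bdd_meas_cmult step_mean_cmult)
  also have "step_mean \<phi> (\<lambda>h s. ln (U h s)) t h s \<le> (\<Sum>(a, j, s')\<in>moves s. weight t h s (a, j, s') *
      ((\<integral>x. U (h(t := (s, a, j, x))) s' \<partial>G (\<phi>' j)) / c - 1 + ln c + I * of_bool (j = i)))"
    unfolding step_mean_def by (intro sum_mono) (auto simp: moves_iff intro!: mult_left_mono weight_nonneg step)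
  also have "\<dots> = (\<Sum>m\<in>moves s. weight t h s m) * (ln c - 1)
      + (\<Sum>(a, j, s')\<in>moves s. weight t h s (a, j, s') * (\<integral>x. U (h(t := (s, a, j, x))) s' \<partial>G (\<phi>' j))) / c
      + I * (\<Sum>m\<in>moves s. weight t h s m * (case m of (a, j, s') \<Rightarrow> of_bool (j = i)))"
    by (simp add: case_prod_beta sum_distrib_left sum_distrib_right sum_divide_distrib
        sum.distrib[symmetric] algebra_simps add_divide_distrib)
  also have "\<dots> = ln c + I * (\<Sum>(a, j)\<in>As s \<times> {..<M}. pmf (L t h s) (a, j) * of_bool (j = i))"
    unfolding step_mean_def[symmetric] c_def[symmetric] sum_moves_choice sum_weight using c1 by simp
  finally show ?case
    using mean_count_Suc[OF \<phi> Suc.prems(2), of "\<lambda>_ j. j = i" n s]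
    by (simp add: I_def N_def c_def U_def distrib_left)
qed

text \<open>Exponential supermartingale: \<open>exp (\<eta> * b)\<close> shrinks by
  \<open>exp (- \<eta> * \<kappa> / 2)\<close> per slot, except that in \<open>z\<close> it may grow
  by \<open>exp \<eta>\<close>, which the factor for the visit takes back. The constants depend
  neither on the history nor on the parameter vector.\<close>

lemma visits_exponential_bound:
  assumes \<kappa>: "\<kappa> > 0"
    and drift: "\<And>s a. a \<in> As s \<Longrightarrow> (\<Sum>s'\<in>UNIV. P s a s' * b s') \<le> b s - \<kappa> + of_bool (s = z)"
  obtains \<eta> K where "\<eta> > 0" "K > 0"
    "\<And>\<phi> n t h s. params \<phi> \<Longrightarrow> h \<in> space (hist_space t) \<Longrightarrow>
      path_mean \<phi> (\<lambda>h. exp (- \<eta> * visit_count (\<lambda>s _. s = z) (t + n) h)) n t h s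
      \<le> K * exp (- \<eta> * visit_count (\<lambda>s _. s = z) t h) * exp (- \<eta> * \<kappa> * n / 2)"
proof -
  define R where "R = 1 + 2 * (\<Sum>s\<in>UNIV. \<bar>b s\<bar>)"
  have bS: "\<bar>b s\<bar> \<le> (\<Sum>s\<in>UNIV. \<bar>b s\<bar>)" for s by (rule member_le_sum) auto
  have R: "\<bar>b s' - b s\<bar> \<le> R" and bR: "- b s \<le> R" for s s'
    using bS[of s] bS[of s'] unfolding R_def by linarith+
  have R1: "R \<ge> 1" unfolding R_def by (simp add: sum_nonneg)
  \<comment> \<open>The first bound keeps the exponents in the range of
    \<open>exp_quadratic_bound\<close>; the second makes the quadratic term cost at most half of the
    drift.\<close>
  define \<eta> where "\<eta> = min (1 / R) (\<kappa> / (2 * R\<^sup>2))"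
  have \<eta>: "\<eta> > 0" using R1 \<kappa> by (simp add: \<eta>_def)
  have "\<eta> \<le> 1 / R" by (simp add: \<eta>_def)
  then have \<eta>R: "\<eta> * R \<le> 1" using R1 by (simp add: field_simps)
  have "\<eta> \<le> \<kappa> / (2 * R\<^sup>2)" by (simp add: \<eta>_def)
  then have "\<eta> * R\<^sup>2 \<le> \<kappa> / 2" using R1 by (simp add: field_simps)
  then have \<eta>R2: "\<eta> * (\<eta> * R\<^sup>2) \<le> \<eta> * (\<kappa> / 2)" using \<eta> by (intro mult_left_mono) auto
  \<comment> \<open>The shift by \<open>R\<close> makes \<open>w\<close> at least 1, as the case of
    no remaining slot requires.\<close>
  define w where "w s = exp (\<eta> * (b s + R))" for s
  have w: "exp (- \<eta> * of_bool (s = z)) * (\<Sum>s'\<in>UNIV. P s a s' * w s') \<le> exp (- \<eta> * \<kappa> / 2) * w s"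
    if a: "a \<in> As s" for s a
  proof -
    have "(\<Sum>s'\<in>UNIV. P s a s' * w s') = (\<Sum>s'\<in>UNIV. P s a s' * exp (\<eta> * (b s' - b s))) * w s"
      unfolding sum_distrib_right
      by (intro sum.cong refl) (simp add: w_def exp_add[symmetric] distrib_left right_diff_distrib)
    also have "(\<Sum>s'\<in>UNIV. P s a s' * exp (\<eta> * (b s' - b s)))
      \<le> (\<Sum>s'\<in>UNIV. P s a s' * (1 + \<eta> * (b s' - b s) + \<eta> * (\<eta> * R\<^sup>2)))"
    proof (intro sum_mono mult_left_mono P_nonneg a)
      fix s'
      have "\<bar>\<eta> * (b s' - b s)\<bar> \<le> \<eta> * R" using R \<eta> by (simp add: abs_mult)
      with \<eta>R have "exp (\<eta> * (b s' - b s)) \<le> 1 + \<eta> * (b s' - b s) + (\<eta> * (b s' - b s))\<^sup>2"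
        by (intro exp_quadratic_bound) auto
      moreover have "(\<eta> * (b s' - b s))\<^sup>2 \<le> (\<eta> * R)\<^sup>2"
        using \<open>\<bar>\<eta> * (b s' - b s)\<bar> \<le> \<eta> * R\<close> by (metis abs_ge_zero power2_abs power_mono)
      ultimately show "exp (\<eta> * (b s' - b s)) \<le> 1 + \<eta> * (b s' - b s) + \<eta> * (\<eta> * R\<^sup>2)"
        by (simp add: power2_eq_square mult_ac)
    qed
    also have "\<dots> = 1 + \<eta> * ((\<Sum>s'\<in>UNIV. P s a s' * b s') - b s) + \<eta> * (\<eta> * R\<^sup>2)"
    proof -
      have "(\<Sum>s'\<in>UNIV. P s a s' * (1 + \<eta> * (b s' - b s) + \<eta> * (\<eta> * R\<^sup>2)))
        = (\<Sum>s'\<in>UNIV. P s a s') * (1 - \<eta> * b s + \<eta> * (\<eta> * R\<^sup>2)) + \<eta> * (\<Sum>s'\<in>UNIV. P s a s' * b s')"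
        by (simp add: sum_distrib_left sum_distrib_right sum.distrib[symmetric] algebra_simps)
      then show ?thesis using a by (simp add: P_sum algebra_simps)
    qed
    also have "\<dots> \<le> 1 + (\<eta> * (- \<kappa> + of_bool (s = z)) + \<eta> * (\<kappa> / 2))"
    proof -
      have "\<eta> * ((\<Sum>s'\<in>UNIV. P s a s' * b s') - b s) \<le> \<eta> * (- \<kappa> + of_bool (s = z))"
        using drift[OF a] \<eta> by (intro mult_left_mono) auto
      with \<eta>R2 show ?thesis by linarith
    qed
    also have "\<dots> \<le> exp (\<eta> * (- \<kappa> + of_bool (s = z)) + \<eta> * (\<kappa> / 2))"
      by (rule exp_ge_add_one_self)
    also have "\<dots> = exp (\<eta> * of_bool (s = z)) * exp (- \<eta> * \<kappa> / 2)"
      by (simp add: exp_add[symmetric] algebra_simps)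
    finally have "(\<Sum>s'\<in>UNIV. P s a s' * w s') \<le> exp (\<eta> * of_bool (s = z)) * exp (- \<eta> * \<kappa> / 2) * w s"
      by (simp add: w_def)
    then have "exp (- \<eta> * of_bool (s = z)) * (\<Sum>s'\<in>UNIV. P s a s' * w s')
      \<le> exp (- \<eta> * of_bool (s = z)) * (exp (\<eta> * of_bool (s = z)) * exp (- \<eta> * \<kappa> / 2) * w s)"
      by (intro mult_left_mono) auto
    moreover have "exp (- \<eta> * of_bool (s = z)) * exp (\<eta> * of_bool (s = z)) = 1"
      by (simp only: exp_add[symmetric]) simp
    ultimately show ?thesis by (simp only: mult.assoc[symmetric] mult_1)
  qed
  have main: "path_mean \<phi> (\<lambda>h. exp (- \<eta> * visit_count (\<lambda>s _. s = z) (t + n) h)) n t h s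
      \<le> exp (- \<eta> * visit_count (\<lambda>s _. s = z) t h) * exp (- \<eta> * \<kappa> * n / 2) * w s"
    if \<phi>: "params \<phi>" and h: "h \<in> space (hist_space t)" for \<phi> n t h s
    using h
  proof (induction n arbitrary: t h s)
    case 0
    have "1 \<le> w s" using bR[of s] \<eta> by (simp add: w_def)
    then show ?case by simp
  next
    case (Suc n)
    let ?c = "visit_count (\<lambda>s _. s = z)"
    let ?e = "exp (- \<eta> * \<kappa> * n / 2)"
    have bdd_meas_e: "bdd_meas t' (\<lambda>h s. exp (- \<eta> * ?c t' h))" for t'
      by (intro bdd_meas_exp bdd_meas_cmult bdd_meas_visit_count)
    have "?e * exp (\<eta> * (b s + R) + - \<eta> * ?c (Suc t) h) = exp (- \<eta> * ?c (Suc t) h) * ?e * w s" for h s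
      by (simp only: w_def exp_add mult_ac)
    moreover have "bdd_meas (Suc t) (\<lambda>h s. ?e * exp (\<eta> * (b s + R) + - \<eta> * ?c (Suc t) h))"
      by (intro bdd_meas_exp bdd_meas_add bdd_meas_const bdd_meas_cmult bdd_meas_visit_count)
    ultimately have bdd_meas_w: "bdd_meas (Suc t) (\<lambda>h s. exp (- \<eta> * ?c (Suc t) h) * ?e * w s)"
      by (simp only:)
    have "path_mean \<phi> (\<lambda>h. exp (- \<eta> * ?c (t + Suc n) h)) (Suc n) t h s
      \<le> step_mean \<phi> (\<lambda>h s. exp (- \<eta> * ?c (Suc t) h) * ?e * w s) t h s"
      unfolding path_mean.simps
      using Suc.IH[of _ "Suc t"] Suc.prems bdd_meas_e[of "Suc (t + n)"]
      by (intro step_mean_mono \<phi> bdd_meas_w bdd_meas_path_mean) (auto intro: extend_space)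
    also have "\<dots> = (\<Sum>m\<in>moves s. weight t h s m *
        (case m of (a, j, s') \<Rightarrow> exp (- \<eta> * (?c t h + of_bool (s = z))) * ?e * w s'))"
      by (rule step_mean_move[OF \<phi>]) (simp add: visit_count_extend)
    also have "\<dots> = (\<Sum>(a, j)\<in>As s \<times> {..<M}. pmf (L t h s) (a, j) *
        (exp (- \<eta> * ?c t h) * ?e * (exp (- \<eta> * of_bool (s = z)) * (\<Sum>s'\<in>UNIV. P s a s' * w s'))))"
      unfolding sum_moves
      by (intro sum.cong refl) (simp only: case_prod_beta sum_distrib_left distrib_left distrib_right exp_add mult_ac)
    also have "\<dots> \<le> (\<Sum>(a, j)\<in>As s \<times> {..<M}. pmf (L t h s) (a, j) *
        (exp (- \<eta> * ?c t h) * ?e * (exp (- \<eta> * \<kappa> / 2) * w s)))"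
      unfolding case_prod_beta by (intro sum_mono mult_left_mono w) auto
    also have "\<dots> = exp (- \<eta> * ?c t h) * ?e * (exp (- \<eta> * \<kappa> / 2) * w s)"
      using sum_pmf[of t h s] by (simp add: case_prod_beta flip: sum_distrib_right)
    also have "\<dots> = exp (- \<eta> * ?c t h) * exp (- \<eta> * \<kappa> * Suc n / 2) * w s"
      by (simp add: exp_add[symmetric] algebra_simps add_divide_distrib[symmetric])
    finally show ?case .
  qed
  have wK: "w s \<le> (\<Sum>s\<in>UNIV. w s)" for s by (rule member_le_sum) (auto simp: w_def)
  have "(\<Sum>s\<in>UNIV. w s) > 0" by (rule sum_pos) (auto simp: w_def)
  moreover have "path_mean \<phi> (\<lambda>h. exp (- \<eta> * visit_count (\<lambda>s _. s = z) (t + n) h)) n t h s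
      \<le> (\<Sum>s\<in>UNIV. w s) * exp (- \<eta> * visit_count (\<lambda>s _. s = z) t h) * exp (- \<eta> * \<kappa> * n / 2)"
    if "params \<phi>" "h \<in> space (hist_space t)" for \<phi> n t h s
  proof -
    have "exp (- \<eta> * visit_count (\<lambda>s _. s = z) t h) * exp (- \<eta> * \<kappa> * n / 2) * w s
      \<le> exp (- \<eta> * visit_count (\<lambda>s _. s = z) t h) * exp (- \<eta> * \<kappa> * n / 2) * (\<Sum>s\<in>UNIV. w s)"
      by (intro mult_left_mono wK) auto
    from order_trans[OF main[OF that] this] show ?thesis by (simp only: mult_ac)
  qed
  ultimately show thesis using that[of \<eta> "\<Sum>s\<in>UNIV. w s"] \<eta> by blast
qed

end

section \<open>Forced losses and logarithmic growth\<close>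

text \<open>Bellman inequality for the reward \<open>- 1\<close> in \<open>z\<close> and
  \<open>0\<close> elsewhere. The optimal gain is minus the least stationary mass of
  \<open>z\<close> over all policies, and \<kappa> is this mass: a minimum of finitely many positive
  numbers.\<close>

lemma positive_drift:
  fixes As :: "'s::finite \<Rightarrow> real set"
  assumes fin: "\<And>s. finite (As s)" and ne: "\<And>s. As s \<noteq> {}"
    and P0: "\<And>s a s'. a \<in> As s \<Longrightarrow> P s a s' \<ge> 0"
    and P1: "\<And>s a. a \<in> As s \<Longrightarrow> (\<Sum>s'\<in>UNIV. P s a s') = 1"
    and irr: "\<And>\<beta>. \<beta> \<in> policies As \<Longrightarrow> irreducible_chain (induced_chain P \<beta>)"
  obtains b \<kappa> where "\<kappa> > 0"
    "\<And>s a. a \<in> As s \<Longrightarrow> (\<Sum>s'\<in>UNIV. P s a s' * b s') \<le> b s - \<kappa> + of_bool (s = z)"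
proof -
  define gain where "gain = (\<lambda>\<beta>. \<Sum>s\<in>UNIV. stationary_dist (induced_chain P \<beta>) s * - of_bool (s = z))"
  obtain b where b: "\<And>s a. a \<in> As s \<Longrightarrow> - of_bool (s = z) + (\<Sum>s'\<in>UNIV. P s a s' * b s')
      \<le> Max (gain ` policies As) + b s"
    using bellman_inequality[where As = As and P = P, OF fin ne P0 P1 irr, where r = "\<lambda>s a. - of_bool (s = z)"]
    unfolding gain_def by blast
  have "Max (gain ` policies As) \<in> gain ` policies As"
    using policies_finite[of As] policies_nonempty[of As] fin ne by (intro Max_in) auto
  then obtain \<beta> where \<beta>: "\<beta> \<in> policies As" "Max (gain ` policies As) = gain \<beta>" by auto
  have "stochastic (induced_chain P \<beta>)" using P0 P1 \<beta>(1) by (rule induced_stochastic)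
  from stationary_dist_pos[OF this irr[OF \<beta>(1)]]
  have "gain \<beta> < 0"
    by (simp add: gain_def sum_negf of_bool_def if_distrib[where f = "\<lambda>x. _ * x"] cong: if_cong)
  with b \<beta>(2) show thesis
    by (intro that[of "- gain \<beta>" b]) (auto simp: algebra_simps)
qed

text \<open>If no state forced a loss, some policy avoiding channel \<open>i\<close> would attain the gain \<open>\<rho>'\<close>.\<close>

lemma bellman_gap:
  fixes As :: "'s::finite \<Rightarrow> real set" and P :: "'s \<Rightarrow> real \<Rightarrow> 's \<Rightarrow> real"
    and m :: "real \<Rightarrow> nat \<Rightarrow> real" and r :: "real \<Rightarrow> real"
  defines "gain \<equiv> \<lambda>r \<beta>. \<Sum>s\<in>UNIV. stationary_dist (induced_chain P \<beta>) s * r (\<beta> s)"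
  assumes fin: "\<And>s. finite (As s)" and ne: "\<And>s. As s \<noteq> {}"
    and P0: "\<And>s a s'. a \<in> As s \<Longrightarrow> P s a s' \<ge> 0"
    and P1: "\<And>s a. a \<in> As s \<Longrightarrow> (\<Sum>s'\<in>UNIV. P s a s') = 1"
    and irr: "\<And>\<beta>. \<beta> \<in> policies As \<Longrightarrow> irreducible_chain (induced_chain P \<beta>)"
    and r: "\<And>a j. j < M \<Longrightarrow> j \<noteq> i \<Longrightarrow> m a j \<le> r a"
    and best: "\<And>a j. j < M \<Longrightarrow> m a j \<le> best a"
    and \<rho>: "\<rho> = Max (gain best ` policies As)" and less: "Max (gain r ` policies As) < \<rho>"
  obtains z b D where "D > 0"
    "\<And>s a j. a \<in> As s \<Longrightarrow> j < M \<Longrightarrow>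
      m a j + D * of_bool (s = z \<and> j \<noteq> i) + (\<Sum>s'\<in>UNIV. P s a s' * b s') \<le> \<rho> + b s"
proof -
  obtain b where b: "\<And>s a. a \<in> As s \<Longrightarrow> best a + (\<Sum>s'\<in>UNIV. P s a s' * b s') \<le> \<rho> + b s"
    using bellman_inequality[where As = As and P = P, OF fin ne P0 P1 irr, where r = "\<lambda>s. best"]
    unfolding \<rho> gain_def by blast
  define gap where "gap s a j = \<rho> + b s - m a j - (\<Sum>s'\<in>UNIV. P s a s' * b s')" for s a j
  have gap0: "0 \<le> gap s a j" if "a \<in> As s" "j < M" for s a j
    using b[OF that(1)] best[OF that(2), of a] by (simp add: gap_def)
  have "\<exists>z. \<forall>a\<in>As z. \<forall>j<M. j \<noteq> i \<longrightarrow> gap z a j \<noteq> 0"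
  proof (rule ccontr)
    assume "\<not> ?thesis"
    then have "\<forall>s. \<exists>a j. a \<in> As s \<and> j < M \<and> j \<noteq> i \<and> gap s a j = 0" by blast
    then obtain \<beta> c where c: "\<And>s. \<beta> s \<in> As s \<and> c s < M \<and> c s \<noteq> i \<and> gap s (\<beta> s) (c s) = 0"
      by metis
    then have \<beta>: "\<beta> \<in> policies As" by (auto simp: policies_def)
    have "stochastic (induced_chain P \<beta>)" using P0 P1 \<beta> by (rule induced_stochastic)
    then have st: "is_stationary (induced_chain P \<beta>) (stationary_dist (induced_chain P \<beta>))"
      using irr[OF \<beta>] by (rule stationary_dist_is_stationary)
    \<comment> \<open>With all gaps zero the Bellman inequality is an equation along \<beta> and
      \<open>c\<close>, so \<rho> is the average of rewards that never come from channel
      \<open>i\<close>.\<close>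
    have "m (\<beta> s) (c s) + (\<Sum>s'\<in>UNIV. induced_chain P \<beta> s s' * b s') = \<rho> + b s + 0" for s
      using c[of s] by (simp add: gap_def induced_chain_def)
    from stationary_average[OF st this]
    have "\<rho> = (\<Sum>s\<in>UNIV. stationary_dist (induced_chain P \<beta>) s * m (\<beta> s) (c s))" by simp
    also have "\<dots> \<le> gain r \<beta>"
      unfolding gain_def using st c by (intro sum_mono mult_left_mono r) (auto simp: is_stationary_def)
    also have "\<dots> \<le> Max (gain r ` policies As)"
      using policies_finite[of As] fin \<beta> by simp
    finally show False using less by simp
  qed
  then obtain z where z: "\<And>a j. a \<in> As z \<Longrightarrow> j < M \<Longrightarrow> j \<noteq> i \<Longrightarrow> gap z a j > 0"
    using gap0 by (metis less_eq_real_def)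
  \<comment> \<open>The inserted 1 keeps the minimum meaningful when \<open>i\<close> is the only
    channel.\<close>
  define S where "S = insert 1 ((\<lambda>(a, j). gap z a j) ` (As z \<times> ({..<M} - {i})))"
  have S: "finite S" "S \<noteq> {}" unfolding S_def using fin by auto
  have "\<forall>x\<in>S. x > 0" unfolding S_def using z by auto
  then have "Min S > 0" using S by simp
  moreover have "m a j + Min S * of_bool (s = z \<and> j \<noteq> i) + (\<Sum>s'\<in>UNIV. P s a s' * b s') \<le> \<rho> + b s"
    if "a \<in> As s" "j < M" for s a j
  proof (cases "s = z \<and> j \<noteq> i")
    case True
    then have "gap z a j \<in> S" using that unfolding S_def by force
    then have "Min S \<le> gap z a j" using S by simp
    then show ?thesis using True by (simp add: gap_def)
  next
    case False
    then show ?thesis using gap0[OF that] by (auto simp: gap_def)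
  qed
  ultimately show thesis by (rule that)
qed

lemma visit_count_split: "visit_count (\<lambda>s _. s = z) t h \<le> visit_count (\<lambda>_ j. j = i) t h + visit_count (\<lambda>s j. s = z \<and> j \<noteq> i) t h"
  unfolding visit_count_def sum.distrib[symmetric] by (intro sum_mono) auto

text \<open>The chord of the convex exponential makes \<open>exp (l * Y)\<close> linear in
  \<open>Y\<close>, so a bound on the mean of \<open>Y\<close> in the modified problem is
  enough.\<close>

lemma exp_chord:
  fixes y l :: real
  assumes "0 \<le> y" "y \<le> 1"
  shows "exp (l * y) \<le> 1 + y * exp l"
proof -
  have "exp ((1 - y) *\<^sub>R 0 + y *\<^sub>R l) \<le> (1 - y) * exp 0 + y * exp l"
    using assms by (intro convex_onD[OF exp_convex]) auto
  then show ?thesis using assms by (simp add: mult.commute)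
qed

context bandit
begin

lemma hist_0: "(\<lambda>_. undefined) \<in> space (hist_space 0)"
  by (simp add: hist_space_def space_PiM)

text \<open>The change of measure is tested on \<open>l * Y\<close>, with \<open>l\<close> left free
  until the horizon is known to be large. Under \<open>\<phi>\<close> dropping the maximum in
  \<open>Y\<close> gives the left side; under \<open>\<phi>'\<close> the mean of \<open>Y\<close> is
  bounded by rare visits to \<open>z\<close> plus losses there.\<close>

lemma uses_tradeoff:
  fixes s0 z :: 's and \<kappa> :: real
  assumes \<phi>: "params \<phi>" and \<phi>': "params \<phi>'" and i: "i < M"
    and same: "\<And>j. j < M \<Longrightarrow> j \<noteq> i \<Longrightarrow> \<phi>' j = \<phi> j"
    and kl: "kl_finite \<nu> g (\<phi> i) (\<phi>' i)"
    and \<kappa>: "\<kappa> > 0"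
    and drift: "\<And>s a. a \<in> As s \<Longrightarrow> (\<Sum>s'\<in>UNIV. P s a s' * b s') \<le> b s - \<kappa> + of_bool (s = z)"
  defines "u \<equiv> \<lambda>T::nat. mean_count \<phi> (\<lambda>_ j. j = i) T 0 (\<lambda>_. undefined) s0"
    and "v \<equiv> \<lambda>T::nat. mean_count \<phi>' (\<lambda>s j. s = z \<and> j \<noteq> i) T 0 (\<lambda>_. undefined) s0"
  obtains K k :: real where "K > 0" "k > 0"
    "\<And>(T::nat) l. T > 0 \<Longrightarrow> l \<ge> 0 \<Longrightarrow> l * (1 - 4 * u T / (\<kappa> * T))
      \<le> ln (1 + exp l * (K * exp (- k * T) + 4 * v T / (\<kappa> * T))) + KL \<nu> g (\<phi> i) (\<phi>' i) * u T"
proof -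
  obtain \<eta> K where \<eta>: "\<eta> > 0" and K: "K > 0" and visits:
    "\<And>\<phi> n t h s. params \<phi> \<Longrightarrow> h \<in> space (hist_space t) \<Longrightarrow>
      path_mean \<phi> (\<lambda>h. exp (- \<eta> * visit_count (\<lambda>s _. s = z) (t + n) h)) n t h s
      \<le> K * exp (- \<eta> * visit_count (\<lambda>s _. s = z) t h) * exp (- \<eta> * \<kappa> * n / 2)"
    using visits_exponential_bound[OF \<kappa> drift] by metis
  show thesis
  proof (rule that[of K "\<eta> * \<kappa> / 4"])
    fix T :: nat and l :: real assume T: "T > 0" and l: "l \<ge> 0"
    let ?h = "\<lambda>_. undefined :: 's \<times> real \<times> nat \<times> real"
    \<comment> \<open>The visit bound decays like \<open>exp (- \<eta> * \<kappa> * T / 2)\<close>,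
      and the Chernoff factor \<open>exp (\<eta> * c)\<close> uses up half of that exponent. The
      remaining rate is \<open>k = \<eta> * \<kappa> / 4\<close>.\<close>
    define c where "c = \<kappa> * T / 4"
    have c: "c > 0" using \<kappa> T by (simp add: c_def)
    define N where "N = visit_count (\<lambda>(_::'s) j. j = i) T"
    define S where "S = visit_count (\<lambda>(s::'s) j. s = z \<and> j \<noteq> i) T"
    define Z where "Z = visit_count (\<lambda>(s::'s) (_::nat). s = z) T"
    have adms: "bdd_meas (0 + T) (\<lambda>h s. N h)" "bdd_meas (0 + T) (\<lambda>h s. S h)" "bdd_meas (0 + T) (\<lambda>h s. Z h)"
      unfolding N_def S_def Z_def add_0 by (rule bdd_meas_visit_count)+
    have N0: "0 \<le> N h" for h by (simp add: N_def visit_count_nonneg)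
    define Y where "Y h = max 0 (1 - N h / c)" for h
    have Y: "0 \<le> Y h" "Y h \<le> 1" for h using N0[of h] c by (auto simp: Y_def)
    have "N \<in> borel_measurable (hist_space T)" unfolding N_def by (rule visit_count_measurable)
    then have F: "bdd_meas (0 + T) (\<lambda>h s. l * Y h)"
      using Y by (intro bdd_meas_cmult admI[where K = 1]) (auto simp: Y_def[abs_def])
    \<comment> \<open>If \<open>Z h < c\<close> the Chernoff term already exceeds 1. Otherwise
      \<open>N + S\<close> is at least \<open>c\<close>, since every visit to \<open>z\<close> uses
      \<open>i\<close> or is a loss, and then \<open>1 - N / c\<close> is at most
      \<open>S / c\<close>.\<close>
    have Yle: "Y h \<le> exp (\<eta> * c) * exp (- \<eta> * Z h) + 1 / c * S h" for h
    proof (cases "Z h < c")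
      case True
      then have "1 \<le> exp (\<eta> * c) * exp (- \<eta> * Z h)"
        using \<eta> by (simp add: exp_add[symmetric])
      moreover have "0 \<le> 1 / c * S h" using c by (simp add: S_def visit_count_nonneg)
      ultimately show ?thesis using Y(2)[of h] by linarith
    next
      case False
      have "Z h \<le> N h + S h" unfolding Z_def N_def S_def by (rule visit_count_split)
      with False have "1 \<le> (N h + S h) / c" using c by (simp add: field_simps)
      moreover have "0 \<le> 1 / c * S h" using c by (simp add: S_def visit_count_nonneg)
      ultimately have "Y h \<le> 1 / c * S h" by (simp add: Y_def add_divide_distrib)
      then show ?thesis by (smt (verit) exp_gt_zero mult_pos_pos)
    qed
    define W where "W = (\<lambda>h. 1 + (exp l * exp (\<eta> * c) * exp (- \<eta> * Z h) + exp l / c * S h))"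
    have bdd_meas_Z: "bdd_meas (0 + T) (\<lambda>h s. exp l * exp (\<eta> * c) * exp (- \<eta> * Z h))"
      and bdd_meas_S: "bdd_meas (0 + T) (\<lambda>h s. exp l / c * S h)"
      by (intro bdd_meas_cmult bdd_meas_exp adms)+
    have "path_mean \<phi>' (\<lambda>h. exp (l * Y h)) T 0 ?h s0 \<le> path_mean \<phi>' W T 0 ?h s0"
    proof (rule path_mean_mono[OF \<phi>' bdd_meas_exp[OF F] _ _ hist_0])
      show "bdd_meas (0 + T) (\<lambda>h s. W h)" unfolding W_def by (intro bdd_meas_add bdd_meas_Z bdd_meas_S bdd_meas_const)
      fix h
      have "exp (l * Y h) \<le> 1 + Y h * exp l" using Y by (intro exp_chord)
      also have "\<dots> \<le> 1 + (exp (\<eta> * c) * exp (- \<eta> * Z h) + 1 / c * S h) * exp l"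
        using Yle[of h] by simp
      finally show "exp (l * Y h) \<le> W h" by (simp add: W_def algebra_simps)
    qed
    also have "path_mean \<phi>' W T 0 ?h s0 = 1 + (exp l * exp (\<eta> * c) * path_mean \<phi>' (\<lambda>h. exp (- \<eta> * Z h)) T 0 ?h s0
        + exp l / c * v T)"
    proof -
      have "v T = path_mean \<phi>' S T 0 ?h s0" by (simp add: v_def mean_count_def S_def)
      then show ?thesis
        unfolding W_def
        by (simp only: path_mean_add[OF \<phi>' bdd_meas_const bdd_meas_add[OF bdd_meas_Z bdd_meas_S] hist_0]
            path_mean_add[OF \<phi>' bdd_meas_Z bdd_meas_S hist_0] path_mean_cmult[OF \<phi>' hist_0] path_mean_const[OF \<phi>' hist_0])
    qed
    also have "\<dots> \<le> 1 + (exp l * exp (\<eta> * c) * (K * exp (- \<eta> * \<kappa> * T / 2)) + exp l / c * v T)"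
      using visits[OF \<phi>' hist_0, of T s0]
      by (intro add_left_mono add_right_mono mult_left_mono) (auto simp: Z_def)
    also have "\<dots> = 1 + exp l * (K * exp (- (\<eta> * \<kappa> / 4) * T) + 4 * v T / (\<kappa> * T))"
    proof -
      have "exp (\<eta> * c) * exp (- \<eta> * \<kappa> * T / 2) = exp (- (\<eta> * \<kappa> / 4) * T)"
        by (simp add: exp_add[symmetric] c_def)
      then have "exp l * exp (\<eta> * c) * (K * exp (- \<eta> * \<kappa> * T / 2)) = exp l * (K * exp (- (\<eta> * \<kappa> / 4) * T))"
        by (metis mult.assoc mult.left_commute)
      moreover have "exp l / c * v T = exp l * (4 * v T / (\<kappa> * T))" by (simp add: c_def)
      ultimately show ?thesis by (simp only: distrib_left)
    qed
    finally have up: "path_mean \<phi>' (\<lambda>h. exp (l * Y h)) T 0 ?h s0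
      \<le> 1 + exp l * (K * exp (- (\<eta> * \<kappa> / 4) * T) + 4 * v T / (\<kappa> * T))" .
    have "path_mean \<phi>' (\<lambda>_. 1) T 0 ?h s0 \<le> path_mean \<phi>' (\<lambda>h. exp (l * Y h)) T 0 ?h s0"
      using Y l by (intro path_mean_mono \<phi>' bdd_meas_const bdd_meas_exp F hist_0) simp
    then have "1 \<le> path_mean \<phi>' (\<lambda>h. exp (l * Y h)) T 0 ?h s0" by (simp add: path_mean_const[OF \<phi>' hist_0])
    with up have ln_le: "ln (path_mean \<phi>' (\<lambda>h. exp (l * Y h)) T 0 ?h s0)
      \<le> ln (1 + exp l * (K * exp (- (\<eta> * \<kappa> / 4) * T) + 4 * v T / (\<kappa> * T)))" by simp
    have bdd_meas_N: "bdd_meas (0 + T) (\<lambda>h s. (- l / c) * N h)" by (intro bdd_meas_cmult adms)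
    have "path_mean \<phi> (\<lambda>h. l + (- l / c) * N h) T 0 ?h s0 \<le> path_mean \<phi> (\<lambda>h. l * Y h) T 0 ?h s0"
    proof (rule path_mean_mono[OF \<phi> bdd_meas_add[OF bdd_meas_const bdd_meas_N] F _ hist_0])
      fix h
      have "l * (1 - N h / c) \<le> l * Y h" using l by (intro mult_left_mono) (auto simp: Y_def)
      then show "l + - l / c * N h \<le> l * Y h" by (simp add: algebra_simps)
    qed
    also have "path_mean \<phi> (\<lambda>h. l + (- l / c) * N h) T 0 ?h s0 = l + (- l / c) * u T"
    proof -
      have "u T = path_mean \<phi> N T 0 ?h s0" by (simp add: u_def mean_count_def N_def)
      then show ?thesis
        by (simp only: path_mean_add[OF \<phi> bdd_meas_const bdd_meas_N hist_0] path_mean_cmult[OF \<phi> hist_0] path_mean_const[OF \<phi> hist_0])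
    qed
    also have "l + (- l / c) * u T = l * (1 - 4 * u T / (\<kappa> * T))"
      by (simp add: c_def algebra_simps)
    finally have low: "l * (1 - 4 * u T / (\<kappa> * T)) \<le> path_mean \<phi> (\<lambda>h. l * Y h) T 0 ?h s0" .
    have "0 \<le> l * Y h" for h using l Y by simp
    from change_of_measure[OF \<phi> \<phi>' i same kl F this hist_0, of s0] low ln_le
    show "l * (1 - 4 * u T / (\<kappa> * T))
      \<le> ln (1 + exp l * (K * exp (- (\<eta> * \<kappa> / 4) * T) + 4 * v T / (\<kappa> * T))) + KL \<nu> g (\<phi> i) (\<phi>' i) * u T"
      by (simp add: u_def)
  qed (use \<eta> \<kappa> K in auto)
qed

end

text \<open>For \<open>l = (1 - 2 * b) * ln T\<close> the factor \<open>exp l\<close> is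
  \<open>T powr (1 - 2 * b)\<close>, while \<open>v T / T\<close> is of order
  \<open>T powr (b - 1)\<close>. Their product tends to zero like \<open>T powr (- b)\<close>, so
  the logarithm is eventually at most \<open>ln 2\<close>.\<close>

lemma log_growth_from_tradeoff:
  fixes u v :: "nat \<Rightarrow> real"
  assumes pos: "\<kappa> > 0" "I > 0" "K > 0" "k > 0" "D > 0" and b: "0 < b" "b < 1 / 2"
    and tradeoff: "\<And>T l. T > 0 \<Longrightarrow> l \<ge> 0 \<Longrightarrow> l * (1 - 4 * u T / (\<kappa> * T))
      \<le> ln (1 + exp l * (K * exp (- k * T) + 4 * v T / (\<kappa> * T))) + I * u T"
    and v0: "\<And>T. 0 \<le> v T"
    and v: "eventually (\<lambda>T. v T \<le> (real T powr b + C) / D) sequentially"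
  shows "ereal ((1 - 2 * b) / I) \<le> Liminf sequentially (\<lambda>T. ereal (u T / ln (real T)))"
proof -
  \<comment> \<open>Result of solving the tradeoff for \<open>u T\<close> and dividing by
    \<open>ln T\<close>. The term with \<open>u T / T\<close> is moved into the denominator instead
    of being estimated, so no upper bound on \<open>u\<close> is called for.\<close>
  define r where "r T = ((1 - 2 * b) - ln 2 / ln (real T)) / (I + (1 - 2 * b) * 4 / \<kappa> * (ln (real T) / real T))"
    for T :: nat
  have "(\<lambda>T. real T powr (1 - 2 * b) * (K * exp (- k * real T) + 4 / \<kappa> / D * ((real T powr b + C) / real T))) \<longlonglongrightarrow> 0"
    using pos b by real_asymp
  then have "eventually (\<lambda>T. real T powr (1 - 2 * b) *
      (K * exp (- k * real T) + 4 / \<kappa> / D * ((real T powr b + C) / real T)) < 1) sequentially"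
    by (rule order_tendstoD) simp
  with v eventually_gt_at_top[of 1] have "eventually (\<lambda>T. r T \<le> u T / ln (real T)) sequentially"
  proof eventually_elim
    case (elim T)
    define l where "l = (1 - 2 * b) * ln (real T)"
    have lnT: "ln (real T) > 0" and T: "T > 0" using elim by auto
    have l: "l > 0" using lnT b by (simp add: l_def)
    have el: "exp l = real T powr (1 - 2 * b)" using T by (simp add: l_def powr_def)
    have "4 * v T / (\<kappa> * T) \<le> 4 * ((real T powr b + C) / D) / (\<kappa> * T)"
      using elim pos by (intro divide_right_mono mult_left_mono) auto
    then have "exp l * (K * exp (- k * T) + 4 * v T / (\<kappa> * T))
      \<le> exp l * (K * exp (- k * T) + 4 / \<kappa> / D * ((real T powr b + C) / real T))"
      by (intro mult_left_mono add_left_mono) (auto simp: mult_ac)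
    also have "\<dots> < 1" using elim by (simp add: el)
    finally have less: "exp l * (K * exp (- k * T) + 4 * v T / (\<kappa> * T)) < 1" .
    have "0 \<le> exp l * (K * exp (- k * T) + 4 * v T / (\<kappa> * T))" using pos v0 by simp
    with less have "ln (1 + exp l * (K * exp (- k * T) + 4 * v T / (\<kappa> * T))) \<le> ln 2" by simp
    with tradeoff[OF T, of l] l have "l * (1 - 4 * u T / (\<kappa> * T)) \<le> ln 2 + I * u T" by simp
    then have "l - ln 2 \<le> u T * (I + l * 4 / (\<kappa> * T))" by (simp add: algebra_simps)
    moreover have pos': "I + l * 4 / (\<kappa> * T) > 0" using pos l T by (simp add: add_pos_nonneg)
    ultimately have "(l - ln 2) / (I + l * 4 / (\<kappa> * T)) \<le> u T" by (simp add: pos_divide_le_eq)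
    then have "(l - ln 2) / (I + l * 4 / (\<kappa> * T)) / ln (real T) \<le> u T / ln (real T)"
      using lnT by (intro divide_right_mono) auto
    moreover have "(l - ln 2) / (I + l * 4 / (\<kappa> * T)) / ln (real T) = r T"
    proof -
      have "I + l * 4 / (\<kappa> * T) = I + (1 - 2 * b) * 4 / \<kappa> * (ln (real T) / real T)"
        by (simp add: l_def)
      moreover have "(l - ln 2) / ln (real T) = (1 - 2 * b) - ln 2 / ln (real T)"
        using lnT by (simp add: l_def diff_divide_distrib)
      moreover have "x / y / z = x / z / y" for x y z :: real by (simp add: mult.commute)
      ultimately show ?thesis unfolding r_def by metis
    qed
    ultimately show ?case by simp
  qed
  then have "Liminf sequentially (\<lambda>T. ereal (r T)) \<le> Liminf sequentially (\<lambda>T. ereal (u T / ln (real T)))"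
    by (intro Liminf_mono) (auto elim: eventually_mono)
  moreover have "r \<longlonglongrightarrow> ((1 - 2 * b) - 0) / (I + (1 - 2 * b) * 4 / \<kappa> * 0)"
  proof -
    have "(\<lambda>T. ln 2 / ln (real T)) \<longlonglongrightarrow> 0" "(\<lambda>T. ln (real T) / real T) \<longlonglongrightarrow> 0"
      by real_asymp+
    then show ?thesis
      unfolding r_def using pos
      by (intro tendsto_divide tendsto_diff tendsto_add tendsto_mult tendsto_const) auto
  qed
  then have "Liminf sequentially (\<lambda>T. ereal (r T)) = ereal ((1 - 2 * b) / I)"
    by (intro lim_imp_Liminf) auto
  ultimately show ?thesis by simp
qed

section \<open>The lower bound\<close>

lemma rate_nonneg: "B > 0 \<Longrightarrow> 0 \<le> a \<Longrightarrow> 0 \<le> x \<Longrightarrow> 0 \<le> rate B a x"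
  by (simp add: rate_def add_pos_nonneg)

lemma mean_le_best: "j < M \<Longrightarrow> mean_rate B \<nu> g a (\<psi> j) \<le> best_mean B \<nu> g M \<psi> a"
  unfolding best_mean_def by (rule Max_ge) auto

lemma best_mean_attained:
  assumes "M \<ge> 1"
  obtains j where "j < M" "best_mean B \<nu> g M \<psi> a = mean_rate B \<nu> g a (\<psi> j)"
proof -
  have "best_mean B \<nu> g M \<psi> a \<in> (\<lambda>j. mean_rate B \<nu> g a (\<psi> j)) ` {..<M}"
    unfolding best_mean_def using assms by (intro Max_in) (auto simp: lessThan_empty_iff)
  then show thesis using that by auto
qed

lemma opt_channels_nonempty:
  fixes As :: "'s::finite \<Rightarrow> real set"
  assumes "M \<ge> 1" "\<And>s. finite (As s)" "\<And>s. As s \<noteq> {}"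
  shows "opt_channels B \<nu> g M \<psi> P As \<noteq> {}"
proof -
  have "opt_reward B \<nu> g M \<psi> P As \<in> avg_reward B \<nu> g M \<psi> P ` policies As"
    unfolding opt_reward_def
    using policies_finite[of As] policies_nonempty[of As] assms by (intro Max_in) auto
  then obtain \<beta> where \<beta>: "\<beta> \<in> policies As" "avg_reward B \<nu> g M \<psi> P \<beta> = opt_reward B \<nu> g M \<psi> P As"
    by auto
  fix s :: 's
  obtain j where "j < M" "best_mean B \<nu> g M \<psi> (\<beta> s) = mean_rate B \<nu> g (\<beta> s) (\<psi> j)"
    using best_mean_attained[OF assms(1)] by metis
  then have "j \<in> opt_channels B \<nu> g M \<psi> P As"
    unfolding opt_channels_def using \<beta> by (auto intro!: bexI[of _ \<beta>] exI[of _ s])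
  then show ?thesis by auto
qed

theorem theorem8:
  fixes B :: real and M :: nat
    and Acts :: "real set" and As :: "'s::finite \<Rightarrow> real set"
    and P :: "'s \<Rightarrow> real \<Rightarrow> 's \<Rightarrow> real"
    and \<nu> :: "real measure" and X :: "real set"
    and g :: "real \<Rightarrow> 'p \<Rightarrow> real" and \<Psi> :: "'p set"
    and L :: "'s alloc_rule" and s0 :: 's
    and \<psi> :: "nat \<Rightarrow> 'p" and i :: nat
  assumes B_pos: "B > 0" and M_pos: "M \<ge> 1"
    and Acts_fin: "finite Acts" and Acts_nonneg: "Acts \<subseteq> {0..}"
    and As_sub: "\<And>s. As s \<subseteq> Acts" and As_ne: "\<And>s. As s \<noteq> {}"
    and P_nonneg: "\<And>s a s'. a \<in> As s \<Longrightarrow> P s a s' \<ge> 0"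
    and P_sum: "\<And>s a. a \<in> As s \<Longrightarrow> (\<Sum>s'\<in>UNIV. P s a s') = 1"
    and ergodic: "\<And>\<beta>. \<beta> \<in> policies As \<Longrightarrow>
                    irreducible_chain (induced_chain P \<beta>) \<and> aperiodic_chain (induced_chain P \<beta>)"
    and X_nonneg: "X \<subseteq> {0..}"
    and nu_sets: "sets \<nu> = sets (restrict_space borel X)"
    and g_meas: "\<And>\<psi>. \<psi> \<in> \<Psi> \<Longrightarrow> (\<lambda>x. g x \<psi>) \<in> borel_measurable \<nu>"
    and g_nonneg: "\<And>\<psi> x. \<psi> \<in> \<Psi> \<Longrightarrow> x \<in> X \<Longrightarrow> g x \<psi> \<ge> 0"
    and g_density: "\<And>\<psi>. \<psi> \<in> \<Psi> \<Longrightarrow> (\<integral>\<^sup>+ x. ennreal (g x \<psi>) \<partial>\<nu>) = 1"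
    and A1: "\<And>\<psi> a. \<psi> \<in> \<Psi> \<Longrightarrow> a \<in> Acts \<Longrightarrow> integrable \<nu> (\<lambda>x. rate B a x * g x \<psi>)"
    and A2: "\<And>\<psi> a \<delta>. \<psi> \<in> \<Psi> \<Longrightarrow> a \<in> Acts \<Longrightarrow> \<delta> > 0 \<Longrightarrow>
               \<exists>\<psi>'\<in>\<Psi>. mean_rate B \<nu> g a \<psi> < mean_rate B \<nu> g a \<psi>' \<and>
                         mean_rate B \<nu> g a \<psi>' < mean_rate B \<nu> g a \<psi> + \<delta>"
    and A3: "\<And>\<psi> \<psi>'. \<psi> \<in> \<Psi> \<Longrightarrow> \<psi>' \<in> \<Psi> \<Longrightarrow>
               (\<exists>a\<in>Acts. mean_rate B \<nu> g a \<psi> < mean_rate B \<nu> g a \<psi>') \<Longrightarrow>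
               kl_finite \<nu> g \<psi> \<psi>' \<and> 0 < KL \<nu> g \<psi> \<psi>'"
    and A4: "\<And>\<epsilon> a \<psi> \<psi>'. \<epsilon> > 0 \<Longrightarrow> a \<in> Acts \<Longrightarrow> \<psi> \<in> \<Psi> \<Longrightarrow> \<psi>' \<in> \<Psi> \<Longrightarrow>
               mean_rate B \<nu> g a \<psi> < mean_rate B \<nu> g a \<psi>' \<Longrightarrow>
               \<exists>\<delta>>0. \<forall>\<psi>''\<in>\<Psi>. mean_rate B \<nu> g a \<psi>' < mean_rate B \<nu> g a \<psi>'' \<and>
                                mean_rate B \<nu> g a \<psi>'' < mean_rate B \<nu> g a \<psi>' + \<delta> \<longrightarrow>
                                \<bar>KL \<nu> g \<psi> \<psi>' - KL \<nu> g \<psi> \<psi>''\<bar> < \<epsilon>"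
    and L_rule: "is_alloc_rule M As L"
    and L_good: "\<And>\<phi> b. (\<forall>j<M. \<phi> j \<in> \<Psi>) \<Longrightarrow> b > 0 \<Longrightarrow>
                   (\<lambda>T. regret B M As L P \<nu> g \<phi> s0 T) \<in> o(\<lambda>T. real T powr b)"
    and psi_in: "\<forall>j<M. \<psi> j \<in> \<Psi>"
    and i_chan: "i < M"
    and i_notopt: "i \<notin> opt_channels B \<nu> g M \<psi> P As"
  shows "Liminf sequentially (\<lambda>T. ereal (expected_uses L P \<nu> g \<psi> s0 i T / ln (real T)))
           \<ge> ereal (Max ((\<lambda>j. 1 / KL \<nu> g (\<psi> i) (\<psi> j)) ` opt_channels B \<nu> g M \<psi> P As))"
proof -
  have As_fin: "finite (As s)" for s using finite_subset[OF As_sub Acts_fin] .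
  interpret bandit As M P \<nu> X g \<Psi> L
    by unfold_locales (use As_fin P_nonneg P_sum nu_sets g_meas g_nonneg g_density L_rule in auto)
  have irr: "irreducible_chain (induced_chain P \<beta>)" if "\<beta> \<in> policies As" for \<beta>
    using ergodic[OF that] by simp
  have params_\<psi>: "params \<psi>" using psi_in by (simp add: params_def)
  define u where "u T = mean_count \<psi> (\<lambda>_ j. j = i) T 0 (\<lambda>_. undefined) s0" for T
  have uses: "expected_uses L P \<nu> g \<psi> s0 i T = u T" for T
    using exp_cum_uses[OF params_\<psi> hist_0] mean_count_nonneg[OF params_\<psi> hist_0]
    by (simp add: expected_uses_def u_def)
  let ?O = "opt_channels B \<nu> g M \<psi> P As"
  have "finite ?O" by (rule finite_subset[of _ "{..<M}"]) (auto simp: opt_channels_def)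
  moreover have "?O \<noteq> {}" using M_pos As_fin As_ne by (rule opt_channels_nonempty)
  ultimately have "Max ((\<lambda>j. 1 / KL \<nu> g (\<psi> i) (\<psi> j)) ` ?O) \<in> (\<lambda>j. 1 / KL \<nu> g (\<psi> i) (\<psi> j)) ` ?O"
    by (intro Max_in) auto
  then obtain j where j: "j \<in> ?O"
    and Max_eq: "Max ((\<lambda>j. 1 / KL \<nu> g (\<psi> i) (\<psi> j)) ` ?O) = 1 / KL \<nu> g (\<psi> i) (\<psi> j)" by auto
  from j obtain \<beta> s where jM: "j < M" and \<beta>: "\<beta> \<in> policies As"
    and \<beta>_opt: "avg_reward B \<nu> g M \<psi> P \<beta> = opt_reward B \<nu> g M \<psi> P As"
    and js: "mean_rate B \<nu> g (\<beta> s) (\<psi> j) = best_mean B \<nu> g M \<psi> (\<beta> s)"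
    by (auto simp: opt_channels_def)
  \<comment> \<open>A tie in any state of this optimal policy would make \<open>i\<close> an optimal
    channel.\<close>
  have i_less: "mean_rate B \<nu> g (\<beta> s') (\<psi> i) < best_mean B \<nu> g M \<psi> (\<beta> s')" for s'
    using i_notopt i_chan \<beta> \<beta>_opt mean_le_best[OF i_chan, of B \<nu> g "\<beta> s'" \<psi>]
    by (force simp: opt_channels_def less_le)
  have aA: "\<beta> s \<in> Acts" using \<beta> As_sub by (auto simp: policies_def)
  have ij: "mean_rate B \<nu> g (\<beta> s) (\<psi> i) < mean_rate B \<nu> g (\<beta> s) (\<psi> j)"
    using i_less js by simp
  have \<psi>ij: "\<psi> i \<in> \<Psi>" "\<psi> j \<in> \<Psi>" using psi_in i_chan jM by auto
  have Ij: "0 < KL \<nu> g (\<psi> i) (\<psi> j)" using A3[OF \<psi>ij] aA ij by blast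
  \<comment> \<open>One small \<open>b\<close> serves both as the exponent in the regret bound and
    as the tolerance in A4; it tends to zero at the end.\<close>
  have bound: "ereal ((1 - 2 * b) / (KL \<nu> g (\<psi> i) (\<psi> j) + b))
      \<le> Liminf sequentially (\<lambda>T. ereal (u T / ln (real T)))"
    if b: "0 < b" "b < 1 / 2" for b
  proof -
    obtain \<delta> where \<delta>: "\<delta> > 0" and close: "\<And>p. p \<in> \<Psi> \<Longrightarrow>
        mean_rate B \<nu> g (\<beta> s) (\<psi> j) < mean_rate B \<nu> g (\<beta> s) p \<Longrightarrow>
        mean_rate B \<nu> g (\<beta> s) p < mean_rate B \<nu> g (\<beta> s) (\<psi> j) + \<delta> \<Longrightarrow>
        \<bar>KL \<nu> g (\<psi> i) (\<psi> j) - KL \<nu> g (\<psi> i) p\<bar> < b"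
      using A4[OF b(1) aA \<psi>ij ij] by blast
    obtain p where p: "p \<in> \<Psi>" "mean_rate B \<nu> g (\<beta> s) (\<psi> j) < mean_rate B \<nu> g (\<beta> s) p"
      "mean_rate B \<nu> g (\<beta> s) p < mean_rate B \<nu> g (\<beta> s) (\<psi> j) + \<delta>"
      using A2[OF \<psi>ij(2) aA \<delta>] by blast
    have Ip_close: "\<bar>KL \<nu> g (\<psi> i) (\<psi> j) - KL \<nu> g (\<psi> i) p\<bar> < b" by (rule close[OF p])
    have kl: "kl_finite \<nu> g (\<psi> i) p" and Ip: "0 < KL \<nu> g (\<psi> i) p"
      using A3[OF \<psi>ij(1) p(1)] aA ij p(2) by (meson less_trans)+
    define \<phi> where "\<phi> = \<psi>(i := p)"
    have \<phi>_in: "\<forall>j<M. \<phi> j \<in> \<Psi>" using psi_in p(1) by (simp add: \<phi>_def)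
    then have \<phi>: "params \<phi>" by (simp add: params_def)
    \<comment> \<open>By \<open>i_less\<close> the best channels along \<beta> differ from
      \<open>i\<close>, so their parameters survive the modification.\<close>
    have best_mono: "best_mean B \<nu> g M \<psi> (\<beta> s') \<le> best_mean B \<nu> g M \<phi> (\<beta> s')" for s'
    proof -
      obtain j' where j': "j' < M" "best_mean B \<nu> g M \<psi> (\<beta> s') = mean_rate B \<nu> g (\<beta> s') (\<psi> j')"
        using best_mean_attained[OF M_pos] by metis
      with i_less[of s'] have "j' \<noteq> i" by auto
      then show ?thesis using j' mean_le_best[OF j'(1), of B \<nu> g "\<beta> s'" \<phi>] by (simp add: \<phi>_def)
    qed
    have best_strict: "best_mean B \<nu> g M \<psi> (\<beta> s) < best_mean B \<nu> g M \<phi> (\<beta> s)"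
      using js p(2) mean_le_best[OF i_chan, of B \<nu> g "\<beta> s" \<phi>] by (simp add: \<phi>_def)
    have stoch: "stochastic (induced_chain P \<beta>)"
      using P_nonneg P_sum \<beta> by (rule induced_stochastic)
    note \<pi>_pos = stationary_dist_pos[OF stoch irr[OF \<beta>]]
    have "opt_reward B \<nu> g M \<psi> P As < avg_reward B \<nu> g M \<phi> P \<beta>"
      unfolding \<beta>_opt[symmetric] avg_reward_def
    proof (rule sum_strict_mono_ex1)
      show "\<forall>s'\<in>UNIV. stationary_dist (induced_chain P \<beta>) s' * best_mean B \<nu> g M \<psi> (\<beta> s')
        \<le> stationary_dist (induced_chain P \<beta>) s' * best_mean B \<nu> g M \<phi> (\<beta> s')"
        using \<pi>_pos best_mono by (auto intro!: mult_left_mono less_imp_le)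
      show "\<exists>s'\<in>UNIV. stationary_dist (induced_chain P \<beta>) s' * best_mean B \<nu> g M \<psi> (\<beta> s')
        < stationary_dist (induced_chain P \<beta>) s' * best_mean B \<nu> g M \<phi> (\<beta> s')"
        using \<pi>_pos best_strict by (intro bexI[of _ s]) auto
    qed simp
    also have "\<dots> \<le> opt_reward B \<nu> g M \<phi> P As"
      unfolding opt_reward_def using policies_finite[of As] As_fin \<beta> by simp
    finally have opt_less: "opt_reward B \<nu> g M \<psi> P As < opt_reward B \<nu> g M \<phi> P As" .
    define \<rho> where "\<rho> = opt_reward B \<nu> g M \<phi> P As"
    \<comment> \<open>Without channel \<open>i\<close> the modified problem offers nothing beyond
      the old best means. This caps every policy avoiding \<open>i\<close> at the old optimum, which
      lies strictly below \<rho>.\<close>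
    have old: "mean_rate B \<nu> g a (\<phi> j) \<le> best_mean B \<nu> g M \<psi> a" if "j < M" "j \<noteq> i" for a j
      using mean_le_best[OF that(1), of B \<nu> g a \<psi>] that(2) by (simp add: \<phi>_def)
    obtain z c D where D: "D > 0" and bellman: "\<And>s a j. a \<in> As s \<Longrightarrow> j < M \<Longrightarrow>
      mean_rate B \<nu> g a (\<phi> j) + D * of_bool (s = z \<and> j \<noteq> i) + (\<Sum>s'\<in>UNIV. P s a s' * c s') \<le> \<rho> + c s"
    proof (rule bellman_gap[where As = As and P = P and M = M and i = i
          and m = "\<lambda>a j. mean_rate B \<nu> g a (\<phi> j)" and r = "best_mean B \<nu> g M \<psi>"
          and best = "best_mean B \<nu> g M \<phi>" and \<rho> = \<rho>])
      show "\<rho> = Max ((\<lambda>\<beta>. \<Sum>s\<in>UNIV. stationary_dist (induced_chain P \<beta>) s * best_mean B \<nu> g M \<phi> (\<beta> s)) ` policies As)"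
        by (simp add: \<rho>_def opt_reward_def avg_reward_def[abs_def])
      show "Max ((\<lambda>\<beta>. \<Sum>s\<in>UNIV. stationary_dist (induced_chain P \<beta>) s * best_mean B \<nu> g M \<psi> (\<beta> s)) ` policies As) < \<rho>"
        using opt_less by (simp add: \<rho>_def opt_reward_def avg_reward_def[abs_def])
    qed (use As_fin As_ne P_nonneg P_sum irr old mean_le_best in blast)+
    obtain w \<kappa> where \<kappa>: "\<kappa> > 0" and drift:
      "\<And>s a. a \<in> As s \<Longrightarrow> (\<Sum>s'\<in>UNIV. P s a s' * w s') \<le> w s - \<kappa> + of_bool (s = z)"
      by (rule positive_drift[where As = As and P = P and z = z])
        (use As_fin As_ne P_nonneg P_sum irr in blast)+
    define v where "v T = mean_count \<phi> (\<lambda>s j. s = z \<and> j \<noteq> i) T 0 (\<lambda>_. undefined) s0" for T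
    have same: "\<phi> j = \<psi> j" if "j < M" "j \<noteq> i" for j using that by (simp add: \<phi>_def)
    have kl': "kl_finite \<nu> g (\<psi> i) (\<phi> i)" using kl by (simp add: \<phi>_def)
    obtain K k :: real where "K > 0" "k > 0" and tradeoff: "\<And>(T::nat) l. T > 0 \<Longrightarrow> l \<ge> 0 \<Longrightarrow>
      l * (1 - 4 * u T / (\<kappa> * T))
        \<le> ln (1 + exp l * (K * exp (- k * T) + 4 * v T / (\<kappa> * T))) + KL \<nu> g (\<psi> i) (\<phi> i) * u T"
      by (rule uses_tradeoff[OF params_\<psi> \<phi> i_chan same kl' \<kappa> drift, of s0, folded u_def v_def])
        (assumption | rule that; assumption)+
    \<comment> \<open>Makes \<open>c s + C\<close> nonnegative, at the price of a constant
      independent of \<open>T\<close> in the regret bound.\<close>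
    define C where "C = (\<Sum>s\<in>UNIV. \<bar>c s\<bar>)"
    have C: "0 \<le> c s + C" for s
      using member_le_sum[of s UNIV "\<lambda>s. \<bar>c s\<bar>"] by (auto simp: C_def)
    have regret: "D * v T \<le> regret B M As L P \<nu> g \<phi> s0 T + (c s0 + C)" for T
    proof -
      have "exp_cum L P \<nu> g \<phi> (\<lambda>a j x. rate B a x) T 0 (\<lambda>_. undefined) s0
          \<le> ennreal (real T * \<rho> + c s0 + C - D * v T) \<and> 0 \<le> real T * \<rho> + c s0 + C - D * v T"
        unfolding v_def
      proof (rule exp_cum_bellman[OF \<phi> hist_0 _ _ _ C])
        show "0 \<le> rate B a x" if "a \<in> As s" "x \<in> X" for s a x
          using that As_sub Acts_nonneg X_nonneg B_pos by (intro rate_nonneg) auto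
        show "integrable \<nu> (\<lambda>x. rate B a x * g x (\<phi> j))" if "a \<in> As s" "j < M" for s a j
          using that As_sub \<phi>_in by (intro A1) auto
      qed (use bellman in \<open>simp add: mean_rate_def\<close>)
      then have "expected_reward B L P \<nu> g \<phi> s0 T \<le> real T * \<rho> + c s0 + C - D * v T"
        unfolding expected_reward_def by (simp add: enn2real_leI)
      then show ?thesis by (simp add: regret_def \<rho>_def)
    qed
    \<comment> \<open>The assumption on the rule is invoked at the modified vector: a rule that
      explored \<open>i\<close> too little would pay there.\<close>
    have "eventually (\<lambda>T. norm (regret B M As L P \<nu> g \<phi> s0 T) \<le> 1 * norm (real T powr b)) sequentially"
      using landau_o.smallD[OF L_good[OF \<phi>_in b(1)], of 1] by simp
    then have "eventually (\<lambda>T. v T \<le> (real T powr b + (c s0 + C)) / D) sequentially"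
    proof eventually_elim
      case (elim T)
      with regret[of T] have "D * v T \<le> real T powr b + (c s0 + C)" by simp
      then show ?case using D by (simp add: pos_le_divide_eq mult.commute)
    qed
    moreover have "0 \<le> v T" for T unfolding v_def by (rule mean_count_nonneg[OF \<phi> hist_0])
    ultimately have "ereal ((1 - 2 * b) / KL \<nu> g (\<psi> i) p) \<le> Liminf sequentially (\<lambda>T. ereal (u T / ln (real T)))"
      using \<kappa> Ip \<open>K > 0\<close> \<open>k > 0\<close> D b tradeoff
      by (intro log_growth_from_tradeoff[where \<kappa> = \<kappa> and K = K and k = k and D = D and v = v])
        (auto simp: \<phi>_def)
    moreover have "(1 - 2 * b) / (KL \<nu> g (\<psi> i) (\<psi> j) + b) \<le> (1 - 2 * b) / KL \<nu> g (\<psi> i) p"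
      using Ip Ip_close b by (intro divide_left_mono) (auto intro!: mult_pos_pos)
    ultimately show ?thesis by (meson ereal_less_eq(3) order_trans)
  qed
  \<comment> \<open>The limit inferior does not depend on \<open>b\<close>, so the bound passes to
    the limit from the right; positivity of the divergence keeps the quotient continuous at
    zero.\<close>
  have "((\<lambda>b. (1 - 2 * b) / (KL \<nu> g (\<psi> i) (\<psi> j) + b)) \<longlongrightarrow> (1 - 2 * 0) / (KL \<nu> g (\<psi> i) (\<psi> j) + 0)) (at_right 0)"
    using Ij by (intro tendsto_intros) auto
  then have "((\<lambda>b. ereal ((1 - 2 * b) / (KL \<nu> g (\<psi> i) (\<psi> j) + b))) \<longlongrightarrow> ereal (1 / KL \<nu> g (\<psi> i) (\<psi> j))) (at_right 0)"
    by simp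
  moreover have "eventually (\<lambda>b. ereal ((1 - 2 * b) / (KL \<nu> g (\<psi> i) (\<psi> j) + b))
      \<le> Liminf sequentially (\<lambda>T. ereal (u T / ln (real T)))) (at_right 0)"
    unfolding eventually_at_right_field by (intro exI[of _ "1/2"]) (auto intro!: bound)
  ultimately have "ereal (1 / KL \<nu> g (\<psi> i) (\<psi> j)) \<le> Liminf sequentially (\<lambda>T. ereal (u T / ln (real T)))"
    by (rule tendsto_upperbound) simp
  then show ?thesis unfolding Max_eq uses .
qed

end
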